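(* Let $A$ be a square complex matrix, let $z_1,\dots,z_n\in\mathbb C$ be arbitrary (possibly repetitive) points of interpolation, let $f$ be an analytic function defined in a neighborhood of the convex hull of the union of the spectrum of $A$ and the set $\{z_1,\dots,z_n\}$, and let $p$ be the interpolation polynomial of $f$ constructed by the points $z_1,\dots,z_n$ (taking into account their multiplicities). Then, for any norm $\lVert\cdot\rVert$ on the space of complex matrices of the same size as $A$, $$\lVert f(A)-p(A)\rVert\le\frac1{n!}\max_{\substack{t\in[0,1]\\ \mu\in\operatorname{co}\{z_1,z_2,\dots,z_n\}}}\bigl\lVert\Omega(A)\,f^{(n)}\bigl((1-t)\mu\mathbf 1+tA\bigr)\bigr\rVert,$$ where $\mathbf 1$ is the identity matrix, $\operatorname{co}$ denotes the convex hull, and $\Omega(z)=\prod_{k=1}^n(z-z_k)$.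
   Context: The interpolation polynomial $p$ of $f$ constructed by $z_1,\dots,z_n$ taking into account multiplicities (Hermite interpolation) is the unique polynomial of degree at most $n-1$ such that, for each distinct value $w$ occurring exactly $m$ times among $z_1,\dots,z_n$, one has $p^{(j)}(w)=f^{(j)}(w)$ for $j=0,\dots,m-1$. For a function $g$ analytic in a neighborhood of the spectrum of a square matrix $M$, $g(M)$ is the matrix defined by the usual holomorphic functional calculus. *)

theory Defs
  imports "HOL-Complex_Analysis.Complex_Analysis"
begin

section \<open>Spectrum and holomorphic functional calculus of a complex matrix\<close>

definition mat_spectrum :: "complex^'n^'n \<Rightarrow> complex set" where
  "mat_spectrum M = {z. \<not> invertible (mat z - M)}"

definition resolvent :: "complex^'n^'n \<Rightarrow> complex \<Rightarrow> complex^'n^'n" where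
  "resolvent M z = matrix_inv (mat z - M)"

(* g(M) is the Cauchy integral (1/(2 pi i)) \<integral> g(z) (z1 - M)^(-1) dz. The contour consists of
   one positively oriented circle of radius r around each eigenvalue; for all sufficiently small r
   the integral is the same (eventually_matrix_fun below), and the value agrees with
   the one for any other admissible contour (matrix_fun_contour below). *)
definition matrix_fun :: "(complex \<Rightarrow> complex) \<Rightarrow> complex^'n^'n \<Rightarrow> complex^'n^'n" where
  "matrix_fun g M = (THE B. \<forall>\<^sub>F r in at_right 0. \<forall>i j. B $ i $ j =
      1 / (2 * of_real pi * \<i>) *
      (\<Sum>\<mu>\<in>mat_spectrum M.
         contour_integral (circlepath \<mu> r) (\<lambda>z. g z * resolvent M z $ i $ j)))"

lemma finite_mat_spectrum: "finite (mat_spectrum (M :: complex^'n^'n))"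
proof -
  define P :: "complex poly^'n^'n" where
    "P = (\<chi> i j. (if i = j then [:0, 1:] else 0) - [:M $ i $ j:])"
  have P: "poly (det P) z = det (mat z - M)" for z
    by (simp add: det_def poly_sum poly_mult poly_prod P_def mat_def if_distrib[of "\<lambda>p. poly p z"]
        of_int_poly cong: if_cong)
  have "det P \<noteq> 0"
  proof
    assume "det P = 0"
    then have zero: "det (mat z - M) = 0" for z
      using P[of z] by simp
    have "det (mat 1 - (\<chi> i j. w * M $ i $ j)) = 0" if "w \<noteq> 0" for w
    proof -
      have "(mat 1 - (\<chi> i j. w * M $ i $ j)) = (\<chi> i. w *s (mat (1 / w) - M) $ i)"
        using that by (simp add: vec_eq_iff mat_def algebra_simps)
      then show ?thesis
        by (simp only: det_rows_mul vec_lambda_eta zero mult_zero_right)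
    qed
    then have "\<forall>\<^sub>F w in at 0. det (mat 1 - (\<chi> i j. w * M $ i $ j)) = 0"
      by (simp add: eventually_at_filter)
    then have lim0: "((\<lambda>w. det (mat 1 - (\<chi> i j. w * M $ i $ j))) \<longlongrightarrow> 0) (at 0)"
      by (rule tendsto_eventually)
    have "((\<lambda>w. det (mat 1 - (\<chi> i j. w * M $ i $ j))) \<longlongrightarrow>
        det (mat 1 - (\<chi> i j. 0 * M $ i $ j))) (at 0)"
      unfolding det_def by (auto intro!: tendsto_eq_intros)
    moreover have "mat 1 - (\<chi> i j. 0 * M $ i $ j) = (mat 1 :: complex^'n^'n)"
      by (simp add: vec_eq_iff)
    ultimately have "((\<lambda>w. det (mat 1 - (\<chi> i j. w * M $ i $ j))) \<longlongrightarrow> 1) (at 0)"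
      by simp
    with lim0 show False
      using tendsto_unique[OF at_neq_bot] by fastforce
  qed
  then have "finite {z. poly (det P) z = 0}"
    by (rule poly_roots_finite)
  then show ?thesis
    by (simp add: mat_spectrum_def invertible_det_nz P)
qed

lemma holomorphic_on_resolvent:
  "(\<lambda>z. resolvent M z $ i $ j) holomorphic_on - mat_spectrum (M :: complex^'n^'n)"
proof -
  define D where "D z = (\<chi> k l. if l = i then axis j 1 $ k else (mat z - M) $ k $ l)" for z
  have eq: "resolvent M z $ i $ j = det (D z) / det (mat z - M)" if "z \<in> - mat_spectrum M" for z
  proof -
    have inv: "invertible (mat z - M)"
      using that by (simp add: mat_spectrum_def)
    then have "(mat z - M) ** resolvent M z = mat 1"
      unfolding invertible_def resolvent_def matrix_inv_def by (rule someI2_ex) simp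
    then have "(mat z - M) *v (resolvent M z *v axis j 1) = axis j 1"
      by (simp add: matrix_vector_mul_assoc)
    moreover have "det (mat z - M) \<noteq> 0"
      using inv invertible_det_nz by blast
    ultimately have "resolvent M z *v axis j 1 =
        (\<chi> k. det (\<chi> i l. if l = k then axis j 1 $ i else (mat z - M) $ i $ l) / det (mat z - M))"
      using cramer by blast
    moreover have "(resolvent M z *v axis j 1) $ i = resolvent M z $ i $ j"
      by (simp add: matrix_vector_mul_component inner_axis matrix_vector_mult_def axis_def
          if_distrib cong: if_cong)
    ultimately show ?thesis
      by (simp add: D_def)
  qed
  have entry: "(\<lambda>z. (mat z - M) $ k $ l) holomorphic_on S" for k l S
    by (cases "k = l") (auto simp: mat_def intro!: holomorphic_intros)
  have entryD: "(\<lambda>z. D z $ k $ l) holomorphic_on S" for k l S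
    using entry[of k l S] by (cases "l = i") (auto simp: D_def)
  have "(\<lambda>z. det (D z) / det (mat z - M)) holomorphic_on - mat_spectrum M"
  proof (rule holomorphic_on_divide)
    show "(\<lambda>z. det (D z)) holomorphic_on - mat_spectrum M"
      unfolding det_def by (intro holomorphic_intros entryD)
    show "(\<lambda>z. det (mat z - M)) holomorphic_on - mat_spectrum M"
      unfolding det_def by (intro holomorphic_intros entry)
  qed (auto simp: mat_spectrum_def invertible_det_nz)
  then show ?thesis
    by (rule holomorphic_transform) (simp add: eq)
qed

lemma
  fixes M :: "complex^'n^'n"
  assumes "open U" "mat_spectrum M \<subseteq> U" "g holomorphic_on U"
  shows matrix_fun_residue: "matrix_fun g M $ i $ j =
          (\<Sum>\<mu>\<in>mat_spectrum M. residue (\<lambda>z. g z * resolvent M z $ i $ j) \<mu>)" (is ?residue)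
    and eventually_matrix_fun: "\<forall>\<^sub>F r in at_right 0. \<forall>i j. matrix_fun g M $ i $ j =
          1 / (2 * of_real pi * \<i>) *
          (\<Sum>\<mu>\<in>mat_spectrum M.
             contour_integral (circlepath \<mu> r) (\<lambda>z. g z * resolvent M z $ i $ j))" (is ?eventually)
proof -
  let ?h = "\<lambda>i j z. g z * resolvent M z $ i $ j"
  define B where "B = (\<chi> i j. \<Sum>\<mu>\<in>mat_spectrum M. residue (?h i j) \<mu>)"
  have "\<forall>\<^sub>F r in at_right 0. \<forall>i j. contour_integral (circlepath \<mu> r) (?h i j) =
      2 * of_real pi * \<i> * residue (?h i j) \<mu>" if "\<mu> \<in> mat_spectrum M" for \<mu>
  proof -
    define V where "V = U - (mat_spectrum M - {\<mu>})"
    have V: "open V" "\<mu> \<in> V"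
      using assms that finite_mat_spectrum[of M]
      by (auto simp: V_def intro!: open_Diff finite_imp_closed)
    have holo: "?h i j holomorphic_on V - {\<mu>}" for i j
      using assms holomorphic_on_resolvent[of M i j]
      by (auto simp: V_def intro!: holomorphic_on_mult elim: holomorphic_on_subset)
    obtain e where e: "e > 0" "cball \<mu> e \<subseteq> V"
      using V open_contains_cball by blast
    have "contour_integral (circlepath \<mu> r) (?h i j) = 2 * of_real pi * \<i> * residue (?h i j) \<mu>"
      if "r > 0" "r < e" for r i j
    proof (rule contour_integral_unique)
      have "cball \<mu> r \<subseteq> V"
        using e that subset_cball[of r e \<mu>] by auto
      then show "(?h i j has_contour_integral 2 * of_real pi * \<i> * residue (?h i j) \<mu>)
          (circlepath \<mu> r)"
        using base_residue[OF V \<open>r > 0\<close> holo] by simp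
    qed
    then show ?thesis
      using e(1) by (auto simp: eventually_at_right_field)
  qed
  then have "\<forall>\<^sub>F r in at_right 0. \<forall>\<mu>\<in>mat_spectrum M. \<forall>i j.
      contour_integral (circlepath \<mu> r) (?h i j) = 2 * of_real pi * \<i> * residue (?h i j) \<mu>"
    using finite_mat_spectrum[of M] by (intro eventually_ball_finite) auto
  then have ev: "\<forall>\<^sub>F r in at_right 0. \<forall>i j. B $ i $ j = 1 / (2 * of_real pi * \<i>) *
      (\<Sum>\<mu>\<in>mat_spectrum M. contour_integral (circlepath \<mu> r) (?h i j))"
    by eventually_elim (simp add: B_def flip: sum_distrib_left)
  have unique: "C = B" if "\<forall>\<^sub>F r in at_right 0. \<forall>i j. C $ i $ j = 1 / (2 * of_real pi * \<i>) *
      (\<Sum>\<mu>\<in>mat_spectrum M. contour_integral (circlepath \<mu> r) (?h i j))" for C :: "complex^'n^'n"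
  proof -
    have "\<forall>\<^sub>F r in at_right (0 :: real). C = B"
      using that ev by eventually_elim (simp add: vec_eq_iff)
    then show ?thesis
      by simp
  qed
  have "matrix_fun g M = B"
    unfolding matrix_fun_def by (rule the_equality, rule ev, erule unique)
  then show ?residue ?eventually
    using ev by (simp_all add: B_def)
qed

lemma matrix_fun_contour:
  fixes M :: "complex^'n^'n"
  assumes "open U" "connected U" "mat_spectrum M \<subseteq> U" "g holomorphic_on U"
    and "valid_path \<gamma>" "pathfinish \<gamma> = pathstart \<gamma>" "path_image \<gamma> \<subseteq> U - mat_spectrum M"
    and "\<And>w. w \<notin> U \<Longrightarrow> winding_number \<gamma> w = 0"
    and "\<And>\<mu>. \<mu> \<in> mat_spectrum M \<Longrightarrow> winding_number \<gamma> \<mu> = 1"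
  shows "matrix_fun g M $ i $ j =
    1 / (2 * of_real pi * \<i>) * contour_integral \<gamma> (\<lambda>z. g z * resolvent M z $ i $ j)"
proof -
  have "(\<lambda>z. g z * resolvent M z $ i $ j) holomorphic_on U - mat_spectrum M"
    using assms(4) holomorphic_on_resolvent[of M i j]
    by (auto intro!: holomorphic_on_mult elim: holomorphic_on_subset)
  then have "contour_integral \<gamma> (\<lambda>z. g z * resolvent M z $ i $ j) = 2 * pi * \<i> *
      (\<Sum>\<mu>\<in>mat_spectrum M.
         winding_number \<gamma> \<mu> * residue (\<lambda>z. g z * resolvent M z $ i $ j) \<mu>)"
    using assms finite_mat_spectrum by (intro Residue_theorem) auto
  then show ?thesis
    using assms by (simp add: matrix_fun_residue[of U])
qed


section \<open>Hermite interpolation and norms\<close>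

definition hermite_interpolant ::
    "(complex \<Rightarrow> complex) \<Rightarrow> nat \<Rightarrow> (nat \<Rightarrow> complex) \<Rightarrow> complex poly \<Rightarrow> bool" where
  "hermite_interpolant f n z p \<longleftrightarrow> degree p \<le> n - 1 \<and>
     (\<forall>w \<in> z ` {1..n}. \<forall>j < card {k \<in> {1..n}. z k = w}.
        poly ((pderiv ^^ j) p) w = (deriv ^^ j) f w)"

definition norm_on_matrices :: "(complex^'n^'n \<Rightarrow> real) \<Rightarrow> bool" where
  "norm_on_matrices N \<longleftrightarrow>
     (\<forall>X. N X \<ge> 0) \<and> (\<forall>X. N X = 0 \<longleftrightarrow> X = 0) \<and>
     (\<forall>c X. N (map_matrix ((*) c) X) = cmod c * N X) \<and>
     (\<forall>X Y. N (X + Y) \<le> N X + N Y)"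

end

theory Submission
  imports Defs
begin

text \<open>
  Subtracting the interpolant, put \<open>h = f - p\<close>: it vanishes at the nodes with multiplicity, and
  \<open>h\<^sup>(\<^sup>n\<^sup>) = f\<^sup>(\<^sup>n\<^sup>)\<close> because \<open>p\<close> has degree below \<open>n\<close>. Dividing out one node after the other gives
  \<open>h = \<Omega> g\<close>, hence \<open>f(A) - p(A) = \<Omega>(A) g(A)\<close>, where dividing out \<open>z\<close> amounts to taking the integral of
  \<open>h'((1 - s) z + s w)\<close> over \<open>s \<in> [0, 1]\<close>. The \<open>k\<close>-th derivative of this integral carries the
  additional weight \<open>s\<^sup>k\<close>, whose mean is \<open>1 / (k + 1)\<close>, so the successive divisions contribute the factor
  \<open>1 / n!\<close>, and nested convex combinations of nodes stay of the form \<open>(1 - t) \<mu> + t w\<close>. This yields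
  the scalar bound for every linear functional that commutes with integrals over \<open>s\<close>.
  A separating hyperplane for a ball of the given norm reduces the matrix inequality to such a functional.
  The functional calculus enters through its contour formula with one fixed radius for all circles.
\<close>

no_notation fps_nth (infixl "$" 75)

section \<open>Divided differences\<close>

text \<open>On a convex open set where \<open>h\<close> is holomorphic this is the first divided
  difference, \<open>(h w - h z) / (w - z)\<close> for \<open>w \<noteq> z\<close>, in
  Hermite-Genocchi form. The integral needs no separate value at \<open>w = z\<close>, and all its
  derivatives arise by differentiating under the integral sign.\<close>

definition divided_difference :: "complex \<Rightarrow> (complex \<Rightarrow> complex) \<Rightarrow> complex \<Rightarrow> complex" where
  "divided_difference z h w = integral {0..1} (\<lambda>s. deriv h ((1 - of_real s) * z + of_real s * w))"

lemma convex_comb_mem: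
  fixes W :: "complex set"
  assumes "convex W" "z \<in> W" "w \<in> W" "s \<in> {0..1}"
  shows "(1 - of_real s) * z + of_real s * w \<in> W"
  using convexD[OF assms(1,2,3), of "1 - s" s] assms(4) by (simp add: scaleR_conv_of_real)

lemma continuous_on_convex_comb:
  assumes "convex W" "z \<in> W" "g holomorphic_on W"
  shows "continuous_on (W \<times> {0..1}) (\<lambda>(w, s). g ((1 - of_real s) * z + of_real s * w))"
proof -
  have "continuous_on (W \<times> {0..1}) (\<lambda>x. g ((1 - of_real (snd x)) * z + of_real (snd x) * fst x))"
    by (rule continuous_on_compose2[OF holomorphic_on_imp_continuous_on[OF assms(3)]])
       (auto intro!: continuous_intros convex_comb_mem assms)
  then show ?thesis by (simp add: case_prod_unfold)
qed

lemma continuous_on_slice: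
  assumes "continuous_on (W \<times> S) (\<lambda>(w, s). F w s)" "w \<in> W"
  shows "continuous_on S (F w)"
proof -
  have "continuous_on S (\<lambda>s. case (w, s) of (w, s) \<Rightarrow> F w s)"
    by (rule continuous_on_compose2[OF assms(1), of _ "\<lambda>s. (w, s)"])
       (use assms(2) in \<open>auto intro!: continuous_intros\<close>)
  then show ?thesis by simp
qed

text \<open>By the chain rule, differentiating the integrand in \<open>w\<close> releases one more
  factor \<open>s\<close>. The weight \<open>s ^ k\<close> is kept general so that the result is the
  induction step for all higher derivatives; its case \<open>k = 0\<close> with
  \<open>g = deriv h\<close> gives holomorphy of the divided difference.\<close>

lemma DERIV_divided_difference_moment:
  assumes "open W" "convex W" "z \<in> W" "w \<in> W" "g holomorphic_on W"
  shows "((\<lambda>w. integral {0..1} (\<lambda>s. of_real s ^ k * g ((1 - of_real s) * z + of_real s * w)))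
    has_field_derivative
    integral {0..1} (\<lambda>s. of_real s ^ Suc k * deriv g ((1 - of_real s) * z + of_real s * w))) (at w)"
proof -
  have mult: "continuous_on (W \<times> {0..1}) (\<lambda>(w, s). of_real s ^ k * F w s)"
    if "continuous_on (W \<times> {0..1}) (\<lambda>(w, s). F w s)" for F :: "complex \<Rightarrow> real \<Rightarrow> complex" and k
    using that unfolding case_prod_unfold by (intro continuous_intros)
  have dg: "deriv g holomorphic_on W"
    using assms holomorphic_deriv by blast
  have "((\<lambda>w. integral (cbox 0 1) (\<lambda>s::real. of_real s ^ k * g ((1 - of_real s) * z + of_real s * w)))
    has_field_derivative
    integral (cbox 0 1) (\<lambda>s. of_real s ^ Suc k * deriv g ((1 - of_real s) * z + of_real s * w)))
    (at w within W)"
  proof (rule leibniz_rule_field_derivative)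
    fix x and s :: real assume x: "x \<in> W" "s \<in> cbox 0 1"
    then have "(g has_field_derivative deriv g ((1 - of_real s) * z + of_real s * x))
        (at ((1 - of_real s) * z + of_real s * x))"
      using assms by (intro holomorphic_derivI) (auto intro!: convex_comb_mem)
    then have "((\<lambda>x. g ((1 - of_real s) * z + of_real s * x)) has_field_derivative
        deriv g ((1 - of_real s) * z + of_real s * x) * of_real s) (at x within W)"
      by (rule DERIV_chain2) (auto intro!: derivative_eq_intros)
    then show "((\<lambda>x. of_real s ^ k * g ((1 - of_real s) * z + of_real s * x)) has_field_derivative
        of_real s ^ Suc k * deriv g ((1 - of_real s) * z + of_real s * x)) (at x within W)"
      by (auto intro!: derivative_eq_intros)
  next
    fix x assume "x \<in> W"
    then show "(\<lambda>s::real. of_real s ^ k * g ((1 - of_real s) * z + of_real s * x)) integrable_on cbox 0 1"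
      using continuous_on_slice[OF mult[OF continuous_on_convex_comb[OF assms(2,3,5)]]]
      by (intro integrable_continuous) simp
  next
    show "continuous_on (W \<times> cbox 0 1)
      (\<lambda>(x, s). of_real s ^ Suc k * deriv g ((1 - of_real s) * z + of_real s * x))"
      using mult[OF continuous_on_convex_comb[OF assms(2,3) dg], of "Suc k"]
      by simp
  qed (use assms in auto)
  then show ?thesis
    using at_within_open[OF assms(4,1)] by simp
qed

lemma higher_deriv_divided_difference:
  assumes "open W" "convex W" "z \<in> W" "h holomorphic_on W" "w \<in> W"
  shows "(deriv ^^ k) (divided_difference z h) w =
    integral {0..1} (\<lambda>s. of_real s ^ k * (deriv ^^ Suc k) h ((1 - of_real s) * z + of_real s * w))"
  using assms(5)
proof (induction k arbitrary: w)
  case 0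
  then show ?case by (simp add: divided_difference_def)
next
  case (Suc k)
  have holo: "(deriv ^^ Suc k) h holomorphic_on W"
    using assms holomorphic_higher_deriv by blast
  have "((deriv ^^ k) (divided_difference z h) has_field_derivative
     integral {0..1} (\<lambda>s. of_real s ^ Suc k *
       deriv ((deriv ^^ Suc k) h) ((1 - of_real s) * z + of_real s * w))) (at w)"
    \<comment> \<open>The induction hypothesis is an equality on all of the open set
      \<open>W\<close>, so it may be differentiated.\<close>
    by (rule has_field_derivative_transform_within_open
        [OF DERIV_divided_difference_moment[OF assms(1-3) Suc.prems holo, of k] assms(1) Suc.prems])
       (simp add: Suc.IH)
  then show ?case
    by (simp add: DERIV_imp_deriv)
qed

lemma holomorphic_divided_difference:
  assumes "open W" "convex W" "z \<in> W" "h holomorphic_on W"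
  shows "divided_difference z h holomorphic_on W"
proof -
  have "deriv h holomorphic_on W"
    using assms holomorphic_deriv by blast
  from DERIV_divided_difference_moment[OF assms(1-3) _ this, of _ 0] show ?thesis
    using assms(1) unfolding holomorphic_on_open[OF assms(1)] divided_difference_def[abs_def]
    by auto
qed

text \<open>The fundamental theorem of calculus along the segment from \<open>z\<close> to
  \<open>w\<close>, which convexity keeps inside \<open>W\<close>.\<close>

lemma divided_difference_eq:
  assumes "open W" "convex W" "z \<in> W" "h holomorphic_on W" "w \<in> W"
  shows "h w - h z = (w - z) * divided_difference z h w"
proof -
  let ?l = "\<lambda>s::real. (1 - of_real s) * z + of_real s * w"
  have "((\<lambda>s. (w - z) * deriv h (?l s)) has_integral h (?l 1) - h (?l 0)) {0..1}"
  proof (rule fundamental_theorem_of_calculus)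
    fix s :: real assume s: "s \<in> {0..1}"
    have "(h has_field_derivative deriv h (?l s)) (at (?l s))"
      using assms s by (intro holomorphic_derivI) (auto intro!: convex_comb_mem)
    moreover have "(?l has_vector_derivative (w - z)) (at s within {0..1})"
      by (auto intro!: derivative_eq_intros simp: algebra_simps)
    ultimately have "((h \<circ> ?l) has_vector_derivative (w - z) * deriv h (?l s)) (at s within {0..1})"
      by (rule field_vector_diff_chain_within[rotated, OF has_field_derivative_at_within])
    then show "((\<lambda>s. h (?l s)) has_vector_derivative (w - z) * deriv h (?l s)) (at s within {0..1})"
      by (simp add: o_def)
  qed auto
  then have "integral {0..1} (\<lambda>s. (w - z) * deriv h (?l s)) = h (?l 1) - h (?l 0)"
    by (rule integral_unique)
  then show ?thesis
    by (simp add: divided_difference_def)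
qed

section \<open>Zeros with multiplicity under division by a linear factor\<close>

lemma higher_deriv_linear_factor:
  assumes "open W" "g holomorphic_on W" "v \<in> W"
  shows "(deriv ^^ j) (\<lambda>w. (w - z) * g w) v =
    (v - z) * (deriv ^^ j) g v + of_nat j * (deriv ^^ (j - 1)) g v"
  using assms(3)
proof (induction j arbitrary: v)
  case (Suc j)
  have d: "((deriv ^^ k) g has_field_derivative (deriv ^^ Suc k) g v) (at v)" for k
    using has_field_derivative_higher_deriv[OF assms(2,1) Suc.prems] .
  have "((deriv ^^ j) (\<lambda>w. (w - z) * g w) has_field_derivative
      ((v - z) * (deriv ^^ Suc j) g v + 1 * (deriv ^^ j) g v) + of_nat j * (deriv ^^ Suc (j - 1)) g v) (at v)"
    by (rule has_field_derivative_transform_within_open[OF _ assms(1) Suc.prems Suc.IH[symmetric]])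
       (rule derivative_eq_intros d refl | simp add: algebra_simps)+
  \<comment> \<open>The truncated \<open>j - 1\<close> does no harm at \<open>j = 0\<close>, where
    the coefficient is zero.\<close>
  moreover have "of_nat j * (deriv ^^ Suc (j - 1)) g v = of_nat j * (deriv ^^ j) g v"
    by (cases j) auto
  ultimately have "deriv ((deriv ^^ j) (\<lambda>w. (w - z) * g w)) v =
      (v - z) * (deriv ^^ Suc j) g v + of_nat (Suc j) * (deriv ^^ j) g v"
    using DERIV_imp_deriv by (fastforce simp: algebra_simps)
  then show ?case by simp
qed auto

text \<open>Since \<open>h z = 0\<close>, \<open>h\<close> is \<open>w - z\<close> times its divided
  difference, and the Leibniz rule has only two terms. At \<open>z\<close> one order of vanishing is
  used up, matching the removal of one copy of \<open>z\<close> from the list; at any other node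
  \<open>v\<close> the factor \<open>v - z\<close> is nonzero and no order is lost.\<close>

lemma divided_difference_vanishes:
  assumes "open W" "convex W" "z \<in> W" "h holomorphic_on W"
    and vanish: "\<And>v j. v \<in> W \<Longrightarrow> j < count_list (z # zs) v \<Longrightarrow> (deriv ^^ j) h v = 0"
    and v: "v \<in> W" "j < count_list zs v"
  shows "(deriv ^^ j) (divided_difference z h) v = 0"
proof -
  let ?g = "divided_difference z h"
  have g: "?g holomorphic_on W"
    by (rule holomorphic_divided_difference[OF assms(1-4)])
  have hz: "h z = 0"
    using vanish[of z 0] assms(3) by simp
  have expand: "(deriv ^^ i) h v = (v - z) * (deriv ^^ i) ?g v + of_nat i * (deriv ^^ (i - 1)) ?g v" for i
  proof -
    have "(deriv ^^ i) h v = (deriv ^^ i) (\<lambda>w. (w - z) * ?g w) v"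
    proof (rule higher_deriv_transform_within_open[OF assms(4) _ assms(1) v(1)])
      show "(\<lambda>w. (w - z) * ?g w) holomorphic_on W"
        by (intro holomorphic_intros g)
    qed (use divided_difference_eq[OF assms(1-4)] hz in simp)
    then show ?thesis
      using higher_deriv_linear_factor[OF assms(1) g v(1)] by simp
  qed
  show ?thesis
  proof (cases "v = z")
    case True
    \<comment> \<open>The list \<open>z # zs\<close> contains \<open>z\<close> once more than
      \<open>zs\<close>, so the order \<open>Suc j\<close> is still covered.\<close>
    then have "(deriv ^^ Suc j) h v = 0"
      using vanish[of v "Suc j"] v by simp
    with expand[of "Suc j"] True show ?thesis
      by (simp del: of_nat_Suc funpow.simps)
  next
    case False
    show ?thesis
      using v(2)
    proof (induction j)
      case 0
      then show ?case
        using expand[of 0] vanish[of v 0] v(1) False by simp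
    next
      case (Suc j)
      then have "(deriv ^^ Suc j) h v = 0"
        using vanish[of v "Suc j"] v(1) False by simp
      \<comment> \<open>The lower-order term vanishes by induction, and then \<open>v - z\<close>
        cancels.\<close>
      with expand[of "Suc j"] Suc False show ?case by simp
    qed
  qed
qed

section \<open>The remainder bound for functionals\<close>

lemma convex_comb_nested:
  fixes z \<mu> :: complex
  assumes "s \<in> {0..1}" "t \<in> {0..1}" "t = 1 \<or> \<mu> \<in> convex hull Z"
  obtains \<nu> where "s * t = 1 \<or> \<nu> \<in> convex hull (insert z Z)"
    and "\<And>w. (1 - of_real s) * z + of_real s * ((1 - of_real t) * \<mu> + of_real t * w) =
      (1 - of_real (s * t)) * \<nu> + of_real (s * t) * w"
proof (cases "t = 1")
  \<comment> \<open>Here \<open>\<mu>\<close> has weight zero and may be any point; the inner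
    combination is \<open>w\<close> itself, so \<open>z\<close> serves as the new point.\<close>
  case True
  then show ?thesis
    by (intro that[of z]) (auto intro: hull_inc simp: algebra_simps)
next
  case False
  then have t: "t < 1" and \<mu>: "\<mu> \<in> convex hull Z"
    using assms by auto
  have "s * t \<le> t"
    using assms by (simp add: mult_left_le_one_le)
  then have st: "s * t < 1"
    using t by simp
  \<comment> \<open>In the nested combination \<open>z\<close> has weight \<open>1 - s\<close> and
    \<open>\<mu>\<close> has weight \<open>s * (1 - t)\<close>. Their total is
    \<open>1 - s * t\<close>; dividing by it gives the weights of the new point.\<close>
  define a b where "a = (1 - s) / (1 - s * t)" and "b = s * (1 - t) / (1 - s * t)"
  have ab: "a \<ge> 0" "b \<ge> 0" "a + b = 1"
    using assms st by (auto simp: a_def b_def field_simps mult_left_le simp flip: add_divide_distrib)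
  have eq: "(1 - s * t) * a = 1 - s" "(1 - s * t) * b = s * (1 - t)"
    using st by (auto simp: a_def b_def)
  have "a *\<^sub>R z + b *\<^sub>R \<mu> \<in> convex hull (insert z Z)"
    using ab \<mu> hull_mono[of Z "insert z Z" convex]
    by (intro convexD[OF convex_convex_hull]) (auto intro: hull_inc)
  moreover have "(1 - of_real (s * t)) * (a *\<^sub>R z + b *\<^sub>R \<mu>) =
      (1 - of_real s) * z + of_real s * (1 - of_real t) * \<mu>"
  proof -
    have "(1 - of_real (s * t)) * (a *\<^sub>R z + b *\<^sub>R \<mu>) =
        of_real ((1 - s * t) * a) * z + of_real ((1 - s * t) * b) * \<mu>"
      by (simp add: scaleR_conv_of_real algebra_simps)
    then show ?thesis
      unfolding eq by simp
  qed
  ultimately show ?thesis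
    by (intro that[of "a *\<^sub>R z + b *\<^sub>R \<mu>"]) (auto simp: algebra_simps)
qed

lemma has_integral_power_unit: "((\<lambda>s::real. s ^ n) has_integral 1 / real (Suc n)) {0..1}"
proof -
  have "((\<lambda>s::real. s ^ n) has_integral 1 ^ Suc n / real (Suc n) - 0 ^ Suc n / real (Suc n)) {0..1}"
  proof (rule fundamental_theorem_of_calculus)
    fix s :: real
    have "((\<lambda>s. s ^ Suc n / real (Suc n)) has_real_derivative
        real (Suc n) * s ^ (Suc n - Suc 0) / real (Suc n)) (at s within {0..1})"
      by (rule DERIV_cdivide[OF DERIV_pow])
    then show "((\<lambda>s. s ^ Suc n / real (Suc n)) has_vector_derivative s ^ n) (at s within {0..1})"
      by (simp add: has_real_derivative_iff_has_vector_derivative del: of_nat_Suc)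
  qed simp
  then show ?thesis by simp
qed

text \<open>Induction on the list of nodes, with the divided difference at the head taking the place
  of \<open>h\<close>. The alternative \<open>t = 1\<close> in the bound serves the empty list,
  whose convex hull has no point to offer. The conclusion asserts the factorization and the bound
  for the same \<open>g\<close>, so that the bound can later be read as one on the matrix
  remainder.\<close>

lemma hermite_remainder_functional_bound:
  fixes T :: "(complex \<Rightarrow> complex) \<Rightarrow> complex"
  assumes W: "open W" "convex W"
    and cong: "\<And>g1 g2. (\<And>w. w \<in> W \<Longrightarrow> g1 w = g2 w) \<Longrightarrow> T g1 = T g2"
    and scale: "\<And>c g. g holomorphic_on W \<Longrightarrow> T (\<lambda>w. c * g w) = c * T g"
    and integral: "\<And>F. continuous_on (W \<times> {0..1::real}) (\<lambda>(w, s). F w s) \<Longrightarrow>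
        (\<And>s. s \<in> {0..1} \<Longrightarrow> (\<lambda>w. F w s) holomorphic_on W) \<Longrightarrow>
        ((\<lambda>s. T (\<lambda>w. F w s)) has_integral T (\<lambda>w. integral {0..1} (F w))) {0..1}"
    and h: "h holomorphic_on W" and zs: "set zs \<subseteq> W"
    and vanish: "\<And>v j. v \<in> W \<Longrightarrow> j < count_list zs v \<Longrightarrow> (deriv ^^ j) h v = 0"
    and bound: "\<And>t \<mu>. t \<in> {0..1} \<Longrightarrow> t = 1 \<or> \<mu> \<in> convex hull set zs \<Longrightarrow>
        cmod (T (\<lambda>w. (deriv ^^ length zs) h ((1 - of_real t) * \<mu> + of_real t * w))) \<le> M"
  shows "\<exists>g. g holomorphic_on W \<and> (\<forall>w\<in>W. h w = (\<Prod>z\<leftarrow>zs. w - z) * g w) \<and>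
    cmod (T g) \<le> M / fact (length zs)"
  using h zs vanish bound
proof (induction zs arbitrary: h M)
  case Nil
  \<comment> \<open>At \<open>t = 1\<close> the affine map is the identity, so the assumed bound is
    one on \<open>T h\<close> itself.\<close>
  then show ?case
    using Nil.prems(4)[of 1 0] by (intro exI[of _ h]) simp
next
  case (Cons z zs)
  note h = Cons.prems(1) and vanish = Cons.prems(3) and bound = Cons.prems(4)
  let ?g = "divided_difference z h" and ?n = "length zs"
  let ?H = "(deriv ^^ Suc ?n) h"
  have z: "z \<in> W" and zs: "set zs \<subseteq> W"
    using Cons.prems(2) by auto
  have H: "?H holomorphic_on W"
    using h W(1) by (rule holomorphic_higher_deriv)
  have "\<exists>k. k holomorphic_on W \<and> (\<forall>w\<in>W. ?g w = (\<Prod>z\<leftarrow>zs. w - z) * k w) \<and>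
    cmod (T k) \<le> M / real (Suc ?n) / fact ?n"
  proof (rule Cons.IH)
    show "?g holomorphic_on W"
      by (rule holomorphic_divided_difference[OF W z h])
    show "(deriv ^^ j) ?g v = 0" if "v \<in> W" "j < count_list zs v" for v j
      by (rule divided_difference_vanishes[OF W z h vanish that])
    show "cmod (T (\<lambda>w. (deriv ^^ ?n) ?g ((1 - of_real t) * \<mu> + of_real t * w))) \<le> M / real (Suc ?n)"
      if t: "t \<in> {0..1}" "t = 1 \<or> \<mu> \<in> convex hull set zs" for t \<mu>
    proof -
      define v where "v w = (1 - of_real t) * \<mu> + of_real t * w" for w :: complex
      have v: "v w \<in> W" if "w \<in> W" for w
      proof (cases "t = 1")
        \<comment> \<open>Only for \<open>t < 1\<close> does \<open>\<mu>\<close> have to lie in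
          \<open>W\<close>; at \<open>t = 1\<close> the map \<open>v\<close> is the
          identity.\<close>
        case False
        then have "\<mu> \<in> W"
          using t hull_minimal[of "set zs" W convex] zs W by auto
        then show ?thesis
          unfolding v_def using W that t by (intro convex_comb_mem) auto
      qed (use that in \<open>simp add: v_def\<close>)
      have contv: "continuous_on S (\<lambda>x. v (k x))" if "continuous_on S k" for S and k :: "complex \<times> real \<Rightarrow> complex"
        unfolding v_def by (intro continuous_intros that)
      \<comment> \<open>The integrand that represents the \<open>?n\<close>-th derivative of
        \<open>?g\<close> at \<open>v w\<close>.\<close>
      define F where "F w s = of_real s ^ ?n * ?H ((1 - of_real s) * z + of_real s * v w)" for w and s :: real
      have "continuous_on (W \<times> {0..1})
          (\<lambda>x. (\<lambda>(w, s). ?H ((1 - of_real s) * z + of_real s * w)) (v (fst x), snd x))"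
        by (rule continuous_on_compose2[OF continuous_on_convex_comb[OF W(2) z H]])
           (use v in \<open>auto intro!: continuous_intros contv simp del: funpow.simps\<close>)
      then have contF: "continuous_on (W \<times> {0..1}) (\<lambda>(w, s). F w s)"
        unfolding F_def case_prod_unfold by (intro continuous_intros) simp
      have holo: "(\<lambda>w. ?H ((1 - of_real s) * z + of_real s * v w)) holomorphic_on W"
        if "s \<in> {0..1}" for s
      proof -
        have "(\<lambda>w. (1 - of_real s) * z + of_real s * v w) holomorphic_on W"
          by (auto intro!: holomorphic_intros simp: v_def)
        from holomorphic_on_compose_gen[OF this H] show ?thesis
          using convex_comb_mem[OF W(2) z v that] by (auto simp: o_def)
      qed
      have Fs: "T (\<lambda>w. F w s) = of_real s ^ ?n * T (\<lambda>w. ?H ((1 - of_real s) * z + of_real s * v w))"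
        if "s \<in> {0..1}" for s
        unfolding F_def by (rule scale[OF holo[OF that]])
      have int: "((\<lambda>s. T (\<lambda>w. F w s)) has_integral T (\<lambda>w. integral {0..1} (F w))) {0..1}"
      proof (rule integral[OF contF])
        show "(\<lambda>w. F w s) holomorphic_on W" if "s \<in> {0..1}" for s
          unfolding F_def by (intro holomorphic_intros holo that)
      qed
      have "T (\<lambda>w. (deriv ^^ ?n) ?g (v w)) = T (\<lambda>w. integral {0..1} (F w))"
        by (rule cong) (simp add: higher_deriv_divided_difference[OF W z h v] F_def[abs_def] del: funpow.simps)
      also have "\<dots> = integral {0..1} (\<lambda>s. T (\<lambda>w. F w s))"
        using int by (simp add: integral_unique)
      also have "cmod \<dots> \<le> integral {0..1} (\<lambda>s. s ^ ?n * M)"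
      proof (rule integral_norm_bound_integral)
        show "(\<lambda>s. T (\<lambda>w. F w s)) integrable_on {0..1}"
          using int by blast
        show "(\<lambda>s. s ^ ?n * M) integrable_on {0..1}"
          by (intro integrable_continuous_interval continuous_intros)
        show "cmod (T (\<lambda>w. F w s)) \<le> s ^ ?n * M" if s: "s \<in> {0..1}" for s
        proof -
          \<comment> \<open>The point \<open>\<nu>\<close> does not depend on \<open>w\<close>, so
            the argument of \<open>?H\<close> is again an affine function of \<open>w\<close> of the
            kind controlled by \<open>bound\<close>, now with parameter
            \<open>s * t\<close>.\<close>
          obtain \<nu> where \<nu>: "s * t = 1 \<or> \<nu> \<in> convex hull (insert z (set zs))"
            "\<And>w. (1 - of_real s) * z + of_real s * v w =
              (1 - of_real (s * t)) * \<nu> + of_real (s * t) * w"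
            using convex_comb_nested[OF s t] unfolding v_def by metis
          have "s * t \<in> {0..1}"
            using s t by (auto simp: mult_le_one)
          from bound[OF this, of \<nu>]
          have "cmod (T (\<lambda>w. ?H ((1 - of_real s) * z + of_real s * v w))) \<le> M"
            unfolding \<nu>(2) using \<nu>(1) by (simp del: funpow.simps)
          then show ?thesis
            using s by (simp add: Fs norm_mult norm_power mult_left_mono del: funpow.simps)
        qed
      qed
      \<comment> \<open>The mean of \<open>s ^ ?n\<close> supplies the new factor of the
        factorial.\<close>
      also have "integral {0..1} (\<lambda>s. s ^ ?n * M) = M / real (Suc ?n)"
        by (simp add: integral_unique[OF has_integral_power_unit])
      finally show ?thesis
        by (simp add: v_def)
    qed
  qed (rule zs)
  then obtain k where k: "k holomorphic_on W" "\<And>w. w \<in> W \<Longrightarrow> ?g w = (\<Prod>z\<leftarrow>zs. w - z) * k w"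
    "cmod (T k) \<le> M / real (Suc ?n) / fact ?n"
    by blast
  have "h z = 0"
    using vanish[of z 0] z by simp
  then have "h w = (\<Prod>z\<leftarrow>z # zs. w - z) * k w" if "w \<in> W" for w
    using divided_difference_eq[OF W z h that] k(2)[OF that] by simp
  then show ?case
    using k by (intro exI[of _ k]) (simp add: field_simps)
qed

section \<open>The functional calculus with circles of a fixed radius\<close>

lemma matrix_add_rdistrib:
  fixes A B :: "'a::semiring_1^'n^'m"
  shows "(A + B) ** C = A ** C + B ** C"
  by (simp add: vec_eq_iff matrix_matrix_mult_def distrib_right sum.distrib)

lemma mat_mult_component:
  fixes B :: "'a::semiring_1^'n^'m"
  shows "(mat c ** B) $ i $ j = c * B $ i $ j"
proof -
  have "(mat c ** B) $ i $ j = (\<Sum>k\<in>UNIV. if k = i then c * B $ k $ j else 0)"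
    unfolding matrix_matrix_mult_def mat_def vec_lambda_beta by (rule sum.cong) auto
  then show ?thesis by simp
qed

text \<open>\<open>matrix_fun\<close> is determined by what happens for all sufficiently small
  radii, and how small may depend on the function. With one radius fixed, a whole family of
  functions is integrated over the same circles, which permits linearity, continuity in parameters
  and exchange of integrals.\<close>

definition circle_matrix_fun :: "real \<Rightarrow> (complex \<Rightarrow> complex) \<Rightarrow> complex^'n^'n \<Rightarrow> complex^'n^'n" where
  "circle_matrix_fun r g M = (\<chi> i j. 1 / (2 * of_real pi * \<i>) *
     (\<Sum>\<mu>\<in>mat_spectrum M. contour_integral (circlepath \<mu> r) (\<lambda>z. g z * resolvent M z $ i $ j)))"

text \<open>The discs may overlap; what matters is that each circle stays in \<open>W\<close>,
  avoids the spectrum and encloses only its own eigenvalue.\<close>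

definition isolating_radius :: "complex set \<Rightarrow> complex^'n^'n \<Rightarrow> real \<Rightarrow> bool" where
  "isolating_radius W M r \<longleftrightarrow> r > 0 \<and>
     (\<forall>\<mu>\<in>mat_spectrum M. cball \<mu> r \<subseteq> W \<and> cball \<mu> r \<inter> mat_spectrum M = {\<mu>})"

lemma isolating_radius_exists:
  fixes M :: "complex^'n^'n"
  assumes "open W" "mat_spectrum M \<subseteq> W"
  obtains r where "isolating_radius W M r"
proof -
  have "\<forall>\<^sub>F r in at_right 0. cball \<mu> r \<subseteq> W \<and> cball \<mu> r \<inter> mat_spectrum M = {\<mu>}"
    if \<mu>: "\<mu> \<in> mat_spectrum M" for \<mu>
  proof -
    have "open (W - (mat_spectrum M - {\<mu>}))"
      using assms(1) finite_mat_spectrum[of M] by (auto intro!: open_Diff finite_imp_closed)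
    moreover have "\<mu> \<in> W - (mat_spectrum M - {\<mu>})"
      using \<mu> assms(2) by blast
    ultimately obtain e where e: "e > 0" "cball \<mu> e \<subseteq> W - (mat_spectrum M - {\<mu>})"
      unfolding open_contains_cball by blast
    have "cball \<mu> r \<subseteq> W \<and> cball \<mu> r \<inter> mat_spectrum M = {\<mu>}" if r: "r > 0" "r < e" for r
    proof -
      have "cball \<mu> r \<subseteq> W - (mat_spectrum M - {\<mu>})"
        using e r subset_cball[of r e \<mu>] by auto
      then show ?thesis
        using \<mu> r(1) by auto
    qed
    then show ?thesis
      using e(1) unfolding eventually_at_right_field by blast
  qed
  then have "\<forall>\<^sub>F r in at_right 0. \<forall>\<mu>\<in>mat_spectrum M. cball \<mu> r \<subseteq> W \<and> cball \<mu> r \<inter> mat_spectrum M = {\<mu>}"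
    using finite_mat_spectrum[of M] by (intro eventually_ball_finite) auto
  moreover have "\<forall>\<^sub>F r in at_right (0::real). r > 0"
    by (rule eventually_at_right_less)
  ultimately have "\<forall>\<^sub>F r in at_right 0. isolating_radius W M r"
    unfolding isolating_radius_def by eventually_elim blast
  then show ?thesis
    using that eventually_happens trivial_limit_at_right_real by blast
qed

lemma resolvent_inverse:
  fixes M :: "complex^'n^'n"
  assumes "w \<notin> mat_spectrum M"
  shows "(mat w - M) ** resolvent M w = mat 1" and "resolvent M w ** (mat w - M) = mat 1"
proof -
  have "invertible (mat w - M)"
    using assms by (simp add: mat_spectrum_def)
  then have "(mat w - M) ** resolvent M w = mat 1 \<and> resolvent M w ** (mat w - M) = mat 1"
    unfolding invertible_def resolvent_def matrix_inv_def by (rule someI2_ex) simp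
  then show "(mat w - M) ** resolvent M w = mat 1" "resolvent M w ** (mat w - M) = mat 1"
    by auto
qed

context
  fixes W :: "complex set" and M :: "complex^'n^'n" and r :: real
  assumes r: "isolating_radius W M r"
begin

lemma sphere_avoids_spectrum:
  assumes "\<mu> \<in> mat_spectrum M" "w \<in> sphere \<mu> r"
  shows "w \<in> W" "w \<notin> mat_spectrum M"
proof -
  have "w \<in> cball \<mu> r" "w \<noteq> \<mu>"
    using assms r by (auto simp: isolating_radius_def)
  moreover have "cball \<mu> r \<subseteq> W" "cball \<mu> r \<inter> mat_spectrum M = {\<mu>}"
    using assms(1) r by (simp_all add: isolating_radius_def)
  ultimately show "w \<in> W" "w \<notin> mat_spectrum M"
    by blast+
qed

text \<open>Each circle encloses a single eigenvalue, so its integral is the residue there, and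
  \<open>matrix_fun_residue\<close> expresses \<open>matrix_fun\<close> by the same
  residues.\<close>

lemma matrix_fun_eq_circle:
  assumes "open W" "mat_spectrum M \<subseteq> W" "g holomorphic_on W"
  shows "matrix_fun g M = circle_matrix_fun r g M"
proof -
  have "contour_integral (circlepath \<mu> r) (\<lambda>z. g z * resolvent M z $ i $ j) =
      2 * of_real pi * \<i> * residue (\<lambda>z. g z * resolvent M z $ i $ j) \<mu>"
    if \<mu>: "\<mu> \<in> mat_spectrum M" for \<mu> i j
  proof (rule contour_integral_unique)
    let ?V = "W - (mat_spectrum M - {\<mu>})"
    have "open ?V"
      using assms(1) finite_mat_spectrum[of M] by (auto intro!: open_Diff finite_imp_closed)
    moreover have "\<mu> \<in> ?V" "cball \<mu> r \<subseteq> ?V" "r > 0"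
      using r \<mu> assms(2) by (auto simp: isolating_radius_def)
    moreover have "(\<lambda>z. g z * resolvent M z $ i $ j) holomorphic_on ?V - {\<mu>}"
      using assms(3) holomorphic_on_resolvent[of M i j]
      by (auto intro!: holomorphic_on_mult elim: holomorphic_on_subset)
    ultimately show "((\<lambda>z. g z * resolvent M z $ i $ j) has_contour_integral
        2 * of_real pi * \<i> * residue (\<lambda>z. g z * resolvent M z $ i $ j) \<mu>) (circlepath \<mu> r)"
      using base_residue by auto
  qed
  then show ?thesis
    by (simp add: vec_eq_iff circle_matrix_fun_def matrix_fun_residue[OF assms] sum_distrib_left)
qed

lemma circle_matrix_fun_cong:
  assumes "\<And>w. w \<in> W \<Longrightarrow> g1 w = g2 w"
  shows "circle_matrix_fun r g1 M = circle_matrix_fun r g2 M"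
proof -
  have "r > 0"
    using r by (simp add: isolating_radius_def)
  then have "contour_integral (circlepath \<mu> r) (\<lambda>w. g1 w * resolvent M w $ i $ j) =
      contour_integral (circlepath \<mu> r) (\<lambda>w. g2 w * resolvent M w $ i $ j)"
    if "\<mu> \<in> mat_spectrum M" for \<mu> i j
    using sphere_avoids_spectrum(1)[OF that] assms by (intro contour_integral_cong) auto
  then show ?thesis
    by (simp add: circle_matrix_fun_def)
qed

lemma continuous_on_resolvent_circlepath:
  assumes "\<mu> \<in> mat_spectrum M"
  shows "continuous_on (path_image (circlepath \<mu> r)) (\<lambda>w. resolvent M w $ i $ j)"
proof -
  have "r > 0"
    using r by (simp add: isolating_radius_def)
  then show ?thesis
    using sphere_avoids_spectrum(2)[OF assms]
    by (intro continuous_on_subset[OF holomorphic_on_imp_continuous_on[OF holomorphic_on_resolvent]]) auto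
qed

lemma contour_integrable_resolvent:
  assumes "\<mu> \<in> mat_spectrum M" "continuous_on W g"
  shows "(\<lambda>w. g w * resolvent M w $ i $ j) contour_integrable_on circlepath \<mu> r"
proof -
  have "r > 0"
    using r by (simp add: isolating_radius_def)
  then have "continuous_on (path_image (circlepath \<mu> r)) g"
    using sphere_avoids_spectrum(1)[OF assms(1)] by (intro continuous_on_subset[OF assms(2)]) auto
  then show ?thesis
    by (intro contour_integrable_continuous_circlepath continuous_intros
      continuous_on_resolvent_circlepath assms)
qed

lemma circle_matrix_fun_diff:
  assumes "continuous_on W g1" "continuous_on W g2"
  shows "circle_matrix_fun r (\<lambda>w. g1 w - g2 w) M = circle_matrix_fun r g1 M - circle_matrix_fun r g2 M"
proof -
  have "contour_integral (circlepath \<mu> r) (\<lambda>w. (g1 w - g2 w) * resolvent M w $ i $ j) =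
    contour_integral (circlepath \<mu> r) (\<lambda>w. g1 w * resolvent M w $ i $ j) -
    contour_integral (circlepath \<mu> r) (\<lambda>w. g2 w * resolvent M w $ i $ j)"
    if "\<mu> \<in> mat_spectrum M" for \<mu> i j
    unfolding left_diff_distrib
    using contour_integral_diff contour_integrable_resolvent[OF that] assms by blast
  then show ?thesis
    by (simp add: vec_eq_iff circle_matrix_fun_def sum_subtractf right_diff_distrib diff_divide_distrib)
qed

lemma circle_matrix_fun_scale:
  assumes "continuous_on W g"
  shows "circle_matrix_fun r (\<lambda>w. c * g w) M $ i $ j = c * circle_matrix_fun r g M $ i $ j"
proof -
  have "contour_integral (circlepath \<mu> r) (\<lambda>w. c * g w * resolvent M w $ i $ j) =
    c * contour_integral (circlepath \<mu> r) (\<lambda>w. g w * resolvent M w $ i $ j)"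
    if "\<mu> \<in> mat_spectrum M" for \<mu>
    unfolding mult.assoc
    using contour_integral_lmul contour_integrable_resolvent[OF that] assms by blast
  then show ?thesis
    by (simp add: circle_matrix_fun_def sum_distrib_left mult.left_commute)
qed

text \<open>With \<open>R\<close> the resolvent, \<open>(w - z) R(w) = 1 + (M - z) R(w)\<close>.
  Multiplied by \<open>h\<close> and integrated, the term \<open>1\<close> contributes nothing by
  Cauchy's theorem, because \<open>h\<close> is holomorphic on the whole disc.\<close>

lemma circle_matrix_fun_linear_factor:
  assumes "h holomorphic_on W"
  shows "circle_matrix_fun r (\<lambda>w. (w - z) * h w) M = (M - mat z) ** circle_matrix_fun r h M"
proof -
  have factor: "contour_integral (circlepath \<mu> r) (\<lambda>w. (w - z) * h w * resolvent M w $ i $ j) =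
    (\<Sum>k\<in>UNIV. (M - mat z) $ i $ k *
       contour_integral (circlepath \<mu> r) (\<lambda>w. h w * resolvent M w $ k $ j))"
    if \<mu>: "\<mu> \<in> mat_spectrum M" for \<mu> i j
  proof -
    have r0: "r > 0"
      using r by (simp add: isolating_radius_def)
    have sub: "cball \<mu> r \<subseteq> W"
      using r \<mu> by (simp add: isolating_radius_def)
    have int: "(\<lambda>w. h w * resolvent M w $ k $ j) contour_integrable_on circlepath \<mu> r" for k
      using contour_integrable_resolvent[OF \<mu>] assms holomorphic_on_imp_continuous_on by blast
    have "(h has_contour_integral 0) (circlepath \<mu> r)"
      by (rule Cauchy_theorem_convex_simple[of _ "cball \<mu> r"])
         (use sub r0 assms in \<open>auto intro: holomorphic_on_subset\<close>)
    then have h0: "((\<lambda>w. mat 1 $ i $ j * h w) has_contour_integral mat 1 $ i $ j * 0) (circlepath \<mu> r)"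
      by (rule has_contour_integral_lmul)
    have "((\<lambda>w. mat 1 $ i $ j * h w + (\<Sum>k\<in>UNIV. (M - mat z) $ i $ k * (h w * resolvent M w $ k $ j)))
        has_contour_integral mat 1 $ i $ j * 0 + (\<Sum>k\<in>UNIV. (M - mat z) $ i $ k *
       contour_integral (circlepath \<mu> r) (\<lambda>w. h w * resolvent M w $ k $ j))) (circlepath \<mu> r)"
      by (intro has_contour_integral_add h0 has_contour_integral_sum has_contour_integral_lmul
        has_contour_integral_integral int) auto
    then have "((\<lambda>w. (w - z) * h w * resolvent M w $ i $ j) has_contour_integral
        mat 1 $ i $ j * 0 + (\<Sum>k\<in>UNIV. (M - mat z) $ i $ k *
       contour_integral (circlepath \<mu> r) (\<lambda>w. h w * resolvent M w $ k $ j))) (circlepath \<mu> r)"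
    proof (rule has_contour_integral_eq)
      fix w assume "w \<in> path_image (circlepath \<mu> r)"
      then have "w \<notin> mat_spectrum M"
        using sphere_avoids_spectrum[OF \<mu>] r0 by simp
      then have "((mat w - M) ** resolvent M w + (M - mat z) ** resolvent M w) $ i $ j =
          (mat 1 + (M - mat z) ** resolvent M w) $ i $ j"
        by (simp add: resolvent_inverse)
      moreover have "(mat w - M) ** resolvent M w + (M - mat z) ** resolvent M w = mat (w - z) ** resolvent M w"
      proof -
        have "mat w - M + (M - mat z) = mat (w - z)"
          by (simp add: vec_eq_iff mat_def)
        then show ?thesis
          by (simp only: flip: matrix_add_rdistrib)
      qed
      moreover have "(mat (w - z) ** resolvent M w) $ i $ j = (w - z) * resolvent M w $ i $ j"
        by (rule mat_mult_component)
      ultimately have "(w - z) * resolvent M w $ i $ j = (mat 1 + (M - mat z) ** resolvent M w) $ i $ j"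
        by (simp only:)
      then have "(w - z) * resolvent M w $ i $ j =
          mat 1 $ i $ j + (\<Sum>k\<in>UNIV. (M - mat z) $ i $ k * resolvent M w $ k $ j)"
        by (simp only: matrix_matrix_mult_def vec_lambda_beta vector_add_component)
      then have "h w * ((w - z) * resolvent M w $ i $ j) =
          h w * (mat 1 $ i $ j + (\<Sum>k\<in>UNIV. (M - mat z) $ i $ k * resolvent M w $ k $ j))"
        by simp
      then show "mat 1 $ i $ j * h w + (\<Sum>k\<in>UNIV. (M - mat z) $ i $ k * (h w * resolvent M w $ k $ j)) =
          (w - z) * h w * resolvent M w $ i $ j"
        by (simp only: distrib_left sum_distrib_left mult_ac)
    qed
    then show ?thesis
      by (simp add: contour_integral_unique)
  qed
  have swap: "c * (\<Sum>\<mu>\<in>mat_spectrum M. \<Sum>k\<in>UNIV. a k * I \<mu> k) =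
      (\<Sum>k\<in>UNIV. a k * (c * (\<Sum>\<mu>\<in>mat_spectrum M. I \<mu> k)))" for c and a :: "'n \<Rightarrow> complex" and I
    by (subst sum.swap) (simp add: sum_distrib_left mult.left_commute)
  show ?thesis
    unfolding vec_eq_iff circle_matrix_fun_def matrix_matrix_mult_def vec_lambda_beta
    by (intro allI trans[OF _ swap] arg_cong2[of _ _ _ _ "(*)"] sum.cong refl factor)
qed

end

text \<open>The contour may be replaced by one circle of large radius \<open>\<rho>\<close> about 0.
  There the resolvent differs from \<open>1 / w\<close> times the identity by a term of order
  \<open>1 / \<rho>^2\<close>, while the length of the circle grows only like \<open>\<rho>\<close>;
  the limit \<open>\<rho> \<rightarrow> \<infinity>\<close> leaves the identity matrix.\<close>

lemma matrix_fun_one: "matrix_fun (\<lambda>_. 1) (M :: complex^'n^'n) = mat 1"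
proof -
  \<comment> \<open>\<open>C\<close>, \<open>B w\<close> and \<open>d\<close> are the entrywise sum
    norms of \<open>M\<close>, the resolvent and the identity; this norm is
    submultiplicative.\<close>
  define C where "C = (\<Sum>i\<in>UNIV. \<Sum>j\<in>UNIV. cmod (M $ i $ j))"
  define B where "B w = (\<Sum>i\<in>UNIV. \<Sum>j\<in>UNIV. cmod (resolvent M w $ i $ j))" for w
  define d where "d = (\<Sum>i\<in>UNIV. \<Sum>j\<in>UNIV. cmod ((mat 1 :: complex^'n^'n) $ i $ j))"
  have C0: "C \<ge> 0" and d0: "d \<ge> 0" and B0: "B w \<ge> 0" for w
    by (auto simp: C_def d_def B_def intro!: sum_nonneg)
  have le_B: "cmod (resolvent M w $ i $ j) \<le> B w" for w i j
  proof -
    have "cmod (resolvent M w $ i $ j) \<le> (\<Sum>j\<in>UNIV. cmod (resolvent M w $ i $ j))"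
      by (rule member_le_sum) auto
    also have "\<dots> \<le> B w"
      unfolding B_def by (rule member_le_sum) (auto intro!: sum_nonneg)
    finally show ?thesis .
  qed
  have prod_le: "(\<Sum>i\<in>UNIV. \<Sum>j\<in>UNIV. cmod ((M ** resolvent M w) $ i $ j)) \<le> C * B w" for w
  proof -
    have "(\<Sum>j\<in>UNIV. cmod ((M ** resolvent M w) $ i $ j)) \<le> (\<Sum>k\<in>UNIV. cmod (M $ i $ k)) * B w" for i
    proof -
      have "(\<Sum>j\<in>UNIV. cmod ((M ** resolvent M w) $ i $ j)) \<le>
          (\<Sum>j\<in>UNIV. \<Sum>k\<in>UNIV. cmod (M $ i $ k) * cmod (resolvent M w $ k $ j))"
        by (intro sum_mono) (simp add: matrix_matrix_mult_def sum_norm_le norm_mult)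
      also have "\<dots> = (\<Sum>k\<in>UNIV. cmod (M $ i $ k) * (\<Sum>j\<in>UNIV. cmod (resolvent M w $ k $ j)))"
        by (subst sum.swap) (simp add: sum_distrib_left)
      also have "\<dots> \<le> (\<Sum>k\<in>UNIV. cmod (M $ i $ k) * B w)"
        unfolding B_def by (intro sum_mono mult_left_mono member_le_sum) (auto intro!: sum_nonneg)
      finally show ?thesis by (simp add: sum_distrib_right)
    qed
    then show ?thesis
      unfolding C_def sum_distrib_right[of "\<lambda>i. \<Sum>j\<in>UNIV. cmod (M $ i $ j)"] by (rule sum_mono)
  qed
  have res_eq: "w * resolvent M w $ i $ j = mat 1 $ i $ j + (M ** resolvent M w) $ i $ j"
    if "w \<notin> mat_spectrum M" for w i j
  proof -
    have "((mat w - M) ** resolvent M w + M ** resolvent M w) $ i $ j = (mat 1 + M ** resolvent M w) $ i $ j"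
      using resolvent_inverse[OF that] by simp
    moreover have "(mat w - M) ** resolvent M w + M ** resolvent M w = mat w ** resolvent M w"
      by (simp flip: matrix_add_rdistrib)
    moreover have "(mat w ** resolvent M w) $ i $ j = w * resolvent M w $ i $ j"
      by (rule mat_mult_component)
    ultimately show ?thesis by simp
  qed
  \<comment> \<open>Taking norms in \<open>w R(w) = 1 + M R(w)\<close> gives decay of the resolvent
    \<open>R\<close> once \<open>cmod w\<close> exceeds \<open>C\<close>.\<close>
  have B_le: "(cmod w - C) * B w \<le> d" if "w \<notin> mat_spectrum M" for w
  proof -
    have "cmod w * B w = (\<Sum>i\<in>UNIV. \<Sum>j\<in>UNIV. cmod (w * resolvent M w $ i $ j))"
      by (simp add: B_def sum_distrib_left norm_mult)
    also have "\<dots> \<le> (\<Sum>i\<in>UNIV. \<Sum>j\<in>UNIV. cmod ((mat 1 :: complex^'n^'n) $ i $ j) + cmod ((M ** resolvent M w) $ i $ j))"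
      unfolding res_eq[OF that] by (intro sum_mono norm_triangle_ineq)
    also have "\<dots> \<le> d + C * B w"
      using prod_le[of w] by (simp add: sum.distrib d_def)
    finally show ?thesis by (simp add: algebra_simps)
  qed
  obtain R where R: "\<And>\<mu>. \<mu> \<in> mat_spectrum M \<Longrightarrow> cmod \<mu> < R" "R > C" "R > 0"
  proof -
    have "bounded (mat_spectrum M)"
      by (rule finite_imp_bounded[OF finite_mat_spectrum])
    then obtain b where "\<And>\<mu>. \<mu> \<in> mat_spectrum M \<Longrightarrow> cmod \<mu> \<le> b"
      unfolding bounded_iff by blast
    then show ?thesis
      by (intro that[of "max b C + 1 + \<bar>C\<bar>"]) (use C0 in \<open>force+\<close>)
  qed
  show ?thesis
    unfolding vec_eq_iff
  proof (intro allI)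
    fix i j
    let ?X = "matrix_fun (\<lambda>_. 1) M $ i $ j - mat 1 $ i $ j"
    have bound: "cmod ?X \<le> C * d / (\<rho> - C)" if \<rho>: "\<rho> \<ge> R" for \<rho>
    proof -
      have \<rho>0: "\<rho> > 0" "\<rho> > C"
        using R \<rho> by auto
      have off: "w \<notin> mat_spectrum M" if "cmod w = \<rho>" for w
        using R(1)[of w] that \<rho> by auto
      have eq: "matrix_fun (\<lambda>_. 1) M $ i $ j =
          1 / (2 * of_real pi * \<i>) * contour_integral (circlepath 0 \<rho>) (\<lambda>z. 1 * resolvent M z $ i $ j)"
      proof (rule matrix_fun_contour[of UNIV])
        fix \<mu> assume "\<mu> \<in> mat_spectrum M"
        then have "norm (\<mu> - 0) < \<rho>"
          using R(1) \<rho> by fastforce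
        then show "winding_number (circlepath 0 \<rho>) \<mu> = 1"
          by (rule winding_number_circlepath)
      qed (use off \<rho>0 in auto)
      have cont: "continuous_on (path_image (circlepath 0 \<rho>)) (\<lambda>z. resolvent M z $ i $ j)"
        by (intro continuous_on_subset[OF holomorphic_on_imp_continuous_on[OF holomorphic_on_resolvent]])
           (use \<rho>0 off in auto)
      have res: "((\<lambda>z. resolvent M z $ i $ j) has_contour_integral 2 * of_real pi * \<i> * matrix_fun (\<lambda>_. 1) M $ i $ j)
          (circlepath 0 \<rho>)"
        using has_contour_integral_integral[OF contour_integrable_continuous_circlepath[OF cont]] eq
        by simp
      have inv: "((\<lambda>z. mat 1 $ i $ j * (1 / (z - 0))) has_contour_integral
          mat 1 $ i $ j * (2 * of_real pi * \<i>)) (circlepath 0 \<rho>)"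
        by (intro has_contour_integral_lmul Cauchy_integral_circlepath_simple[where f="\<lambda>_. 1", simplified])
           (use \<rho>0 in auto)
      have "((\<lambda>z. resolvent M z $ i $ j - mat 1 $ i $ j * (1 / (z - 0))) has_contour_integral
         2 * of_real pi * \<i> * ?X) (circlepath 0 \<rho>)"
        using has_contour_integral_diff[OF res inv] by (simp add: algebra_simps)
      \<comment> \<open>Supremum of the integrand times the length of the circle; the integrand is
        an entry of \<open>M ** resolvent M w\<close> divided by \<open>w\<close>.\<close>
      then have "cmod (2 * of_real pi * \<i> * ?X) \<le> (C * d / (\<rho> - C) / \<rho>) * (2 * pi * \<rho>)"
      proof (rule has_contour_integral_bound_circlepath)
        fix w :: complex assume "cmod (w - 0) = \<rho>"
        then have w: "cmod w = \<rho>" "w \<noteq> 0" "w \<notin> mat_spectrum M"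
          using \<rho>0 off by auto
        have "resolvent M w $ i $ j - mat 1 $ i $ j * (1 / (w - 0)) = (M ** resolvent M w) $ i $ j / w"
          using res_eq[OF w(3), of i j] w(2) by (simp add: field_simps)
        also have "cmod \<dots> = cmod ((M ** resolvent M w) $ i $ j) / \<rho>"
          using w by (simp add: norm_divide)
        also have "cmod ((M ** resolvent M w) $ i $ j) \<le> (\<Sum>j\<in>UNIV. cmod ((M ** resolvent M w) $ i $ j))"
          by (rule member_le_sum) auto
        also have "\<dots> \<le> (\<Sum>i\<in>UNIV. \<Sum>j\<in>UNIV. cmod ((M ** resolvent M w) $ i $ j))"
          by (rule member_le_sum[of i UNIV "\<lambda>i. \<Sum>j\<in>UNIV. cmod ((M ** resolvent M w) $ i $ j)"])
             (auto intro!: sum_nonneg)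
        also have "\<dots> \<le> C * B w"
          by (rule prod_le)
        also have "\<dots> \<le> C * (d / (\<rho> - C))"
          using B_le[OF w(3)] w(1) \<rho>0 C0 by (intro mult_left_mono) (auto simp: field_simps)
        finally show "cmod (resolvent M w $ i $ j - mat 1 $ i $ j * (1 / (w - 0))) \<le> C * d / (\<rho> - C) / \<rho>"
          using \<rho>0 by (simp add: divide_right_mono)
      qed (use \<rho>0 C0 d0 in auto)
      moreover have "cmod (2 * of_real pi * \<i> * ?X) = (2 * pi) * cmod ?X"
        by (simp add: norm_mult)
      moreover have "(C * d / (\<rho> - C) / \<rho>) * (2 * pi * \<rho>) = (2 * pi) * (C * d / (\<rho> - C))"
        using \<rho>0 by simp
      ultimately have "(2 * pi) * cmod ?X \<le> (2 * pi) * (C * d / (\<rho> - C))"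
        by (simp only:)
      then show ?thesis
        by (rule mult_left_le_imp_le) simp
    qed
    have "((\<lambda>\<rho>. C * d / (\<rho> - C)) \<longlongrightarrow> 0) at_top"
      by real_asymp
    then have "cmod ?X \<le> 0"
      by (rule tendsto_lowerbound)
         (auto intro!: eventually_mono[OF eventually_ge_at_top[of R]] bound)
    then show "matrix_fun (\<lambda>_. 1) M $ i $ j = mat 1 $ i $ j"
      by simp
  qed
qed

section \<open>Linear factors and affine images of a matrix\<close>

lemma holomorphic_on_linear_factors: "(\<lambda>w. \<Prod>z\<leftarrow>zs. w - z) holomorphic_on W"
  by (induction zs) (auto intro!: holomorphic_intros)

text \<open>For \<open>t > 0\<close> substitute \<open>(1 - t) * \<mu> + t * w\<close> for the
  integration variable: circles of radius \<open>r\<close> become circles of radius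
  \<open>t * r\<close>, the resolvent is divided by \<open>t\<close>, and the differential restores
  the factor \<open>t\<close>. At \<open>t = 0\<close> the substitution collapses, but both sides
  equal \<open>F \<mu>\<close> times the identity. The right side uses the same circles for all
  \<open>t\<close> and \<open>\<mu>\<close>.\<close>

lemma matrix_fun_eq_affine_circle:
  fixes A :: "complex^'n^'n"
  assumes W: "open W" "convex W" and r: "isolating_radius W A r" and A: "mat_spectrum A \<subseteq> W"
    and F: "F holomorphic_on W" and t: "t \<in> {0..1}" and \<mu>: "\<mu> \<in> W"
  shows "matrix_fun F (mat (of_real (1 - t) * \<mu>) + t *\<^sub>R A) =
    circle_matrix_fun r (\<lambda>w. F ((1 - of_real t) * \<mu> + of_real t * w)) A"
proof (cases "t = 0")
  case True
  let ?D = "mat \<mu> :: complex^'n^'n"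
  have "z = \<mu>" if "z \<in> mat_spectrum ?D" for z
  proof (rule ccontr)
    assume "z \<noteq> \<mu>"
    then have "mat (z - \<mu>) ** mat (1 / (z - \<mu>)) = (mat 1 :: complex^'n^'n)"
      by (simp add: vec_eq_iff mat_mult_component) (simp add: mat_def)
    moreover have "mat z - ?D = mat (z - \<mu>)"
      by (simp add: vec_eq_iff mat_def)
    ultimately have "(mat z - ?D) ** mat (1 / (z - \<mu>)) = mat 1"
      by simp
    then show False
      using that invertible_right_inverse by (auto simp: mat_spectrum_def)
  qed
  then have spec: "mat_spectrum ?D \<subseteq> W"
    using \<mu> by blast
  obtain \<rho> where \<rho>: "isolating_radius W ?D \<rho>"
    using isolating_radius_exists[OF W(1) spec] .
  have const: "circle_matrix_fun s (\<lambda>_. c) M = map_matrix ((*) c) (mat 1)"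
    if "isolating_radius W M s" "mat_spectrum M \<subseteq> W" for c s and M :: "complex^'n^'n"
  proof -
    have "circle_matrix_fun s (\<lambda>_. 1) M = mat 1"
      using matrix_fun_eq_circle[OF that(1) W(1) that(2), of "\<lambda>_. 1"] matrix_fun_one[of M] by simp
    then show ?thesis
      using circle_matrix_fun_scale[OF that(1), of "\<lambda>_. 1" c]
      by (simp add: vec_eq_iff map_matrix_def)
  qed
  have dF: "divided_difference \<mu> F holomorphic_on W"
    by (rule holomorphic_divided_difference[OF W \<mu> F])
  \<comment> \<open>The difference \<open>F w - F \<mu>\<close> contains the factor
    \<open>w - \<mu>\<close>, which turns into \<open>?D - mat \<mu> = 0\<close>.\<close>
  have "circle_matrix_fun \<rho> F ?D - circle_matrix_fun \<rho> (\<lambda>_. F \<mu>) ?D =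
      circle_matrix_fun \<rho> (\<lambda>w. F w - F \<mu>) ?D"
    by (rule circle_matrix_fun_diff[OF \<rho>, symmetric])
       (auto intro: holomorphic_on_imp_continuous_on F)
  also have "\<dots> = circle_matrix_fun \<rho> (\<lambda>w. (w - \<mu>) * divided_difference \<mu> F w) ?D"
    by (rule circle_matrix_fun_cong[OF \<rho>]) (rule divided_difference_eq[OF W \<mu> F])
  also have "\<dots> = 0"
    using circle_matrix_fun_linear_factor[OF \<rho> dF] by simp
  finally have "matrix_fun F ?D = map_matrix ((*) (F \<mu>)) (mat 1)"
    using matrix_fun_eq_circle[OF \<rho> W(1) spec F] const[OF \<rho> spec] by simp
  then show ?thesis
    using True const[OF r A] by simp
next
  case False
  then have t: "t > 0" "t \<le> 1"
    using t by auto
  define b where "b = (1 - of_real t) * \<mu>"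
  define B where "B = mat b + t *\<^sub>R A"
  let ?a = "\<lambda>w. b + of_real t * w"
  have aW: "?a w \<in> W" if "w \<in> W" for w
    using convex_comb_mem[OF W(2) \<mu> that, of t] t by (simp add: b_def)
  have shift: "mat (?a w) - B = t *\<^sub>R (mat w - A)" for w
    by (simp add: vec_eq_iff B_def mat_def) (simp add: scaleR_conv_of_real algebra_simps)
  have spec_iff: "?a w \<in> mat_spectrum B \<longleftrightarrow> w \<in> mat_spectrum A" for w
  proof -
    have "invertible (t *\<^sub>R X) \<longleftrightarrow> invertible X" for X :: "complex^'n^'n"
      using scalar_invertible[of t X] scalar_invertible[of "1 / t" "t *\<^sub>R X"] t by auto
    then show ?thesis
      by (simp add: mat_spectrum_def shift)
  qed
  have surj: "z = ?a ((z - b) / of_real t)" for z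
    using t by simp
  have spec: "mat_spectrum B = ?a ` mat_spectrum A"
    using spec_iff surj by (metis (no_types, lifting) image_iff subsetI subset_antisym image_subsetI)
  have inj: "inj_on ?a S" for S
    using t by (auto simp: inj_on_def)
  have res: "resolvent B (?a w) = (1 / t) *\<^sub>R resolvent A w" if "w \<notin> mat_spectrum A" for w
  proof -
    have "(t *\<^sub>R (mat w - A)) ** resolvent B (?a w) = mat 1"
      using resolvent_inverse(1)[of "?a w" B] that spec_iff shift by simp
    then have "resolvent A w ** ((t *\<^sub>R (mat w - A)) ** resolvent B (?a w)) = resolvent A w"
      by simp
    moreover have "resolvent A w ** ((t *\<^sub>R (mat w - A)) ** resolvent B (?a w)) = t *\<^sub>R resolvent B (?a w)"
      using resolvent_inverse(2)[OF that]
      by (simp add: matrix_mul_assoc matrix_scalar_ac flip: scalar_matrix_assoc)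
    ultimately show ?thesis
      using t by (metis (no_types, lifting) divide_self_if less_numeral_extra(3) scaleR_one scaleR_scaleR times_divide_eq_left mult_1)
  qed
  have r0: "r > 0"
    using r by (simp add: isolating_radius_def)
  have ball: "z \<in> cball (?a \<kappa>) (t * r) \<longleftrightarrow> (z - b) / of_real t \<in> cball \<kappa> r" for z \<kappa>
  proof -
    have "?a \<kappa> - z = of_real t * (\<kappa> - (z - b) / of_real t)"
      using t by (simp add: field_simps)
    then have "dist (?a \<kappa>) z = t * dist \<kappa> ((z - b) / of_real t)"
      using t by (simp only: dist_norm norm_mult) simp
    then show ?thesis
      using t by simp
  qed
  \<comment> \<open>The affine map carries the discs around the eigenvalues of \<open>A\<close> onto
    those around the eigenvalues of \<open>B\<close>, and by convexity it maps \<open>W\<close> into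
    \<open>W\<close>.\<close>
  have rB: "isolating_radius W B (t * r)"
    unfolding isolating_radius_def
  proof (intro conjI ballI)
    show "t * r > 0"
      using t r0 by simp
    fix \<kappa>' assume "\<kappa>' \<in> mat_spectrum B"
    then obtain \<kappa> where \<kappa>: "\<kappa>' = ?a \<kappa>" "\<kappa> \<in> mat_spectrum A"
      using spec by auto
    then have cball: "cball \<kappa> r \<subseteq> W" "cball \<kappa> r \<inter> mat_spectrum A = {\<kappa>}"
      using r by (auto simp: isolating_radius_def)
    show "cball \<kappa>' (t * r) \<subseteq> W"
    proof
      fix z assume "z \<in> cball \<kappa>' (t * r)"
      then have "(z - b) / of_real t \<in> W"
        using ball cball(1) \<kappa>(1) by blast
      then show "z \<in> W"
        using aW surj by metis
    qed
    show "cball \<kappa>' (t * r) \<inter> mat_spectrum B = {\<kappa>'}"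
    proof (intro equalityI subsetI)
      fix z assume z: "z \<in> cball \<kappa>' (t * r) \<inter> mat_spectrum B"
      then have "(z - b) / of_real t \<in> cball \<kappa> r"
        using ball \<kappa>(1) by blast
      moreover have "(z - b) / of_real t \<in> mat_spectrum A"
        using z spec_iff[of "(z - b) / of_real t"] surj[of z] by auto
      ultimately have "(z - b) / of_real t = \<kappa>"
        using cball(2) by blast
      then show "z \<in> {\<kappa>'}"
        using surj[of z] \<kappa>(1) by simp
    qed (use \<open>\<kappa>' \<in> mat_spectrum B\<close> t r0 in simp)
  qed
  have specW: "mat_spectrum B \<subseteq> W"
    using spec aW A by auto
  have "contour_integral (circlepath (?a \<kappa>) (t * r)) (\<lambda>z. F z * resolvent B z $ i $ j) =
      contour_integral (circlepath \<kappa> r) (\<lambda>z. F (?a z) * resolvent A z $ i $ j)"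
    if \<kappa>: "\<kappa> \<in> mat_spectrum A" for \<kappa> i j
    unfolding contour_integral_integral
  proof (rule integral_cong)
    fix x :: real assume "x \<in> {0..1}"
    then have "circlepath \<kappa> r x \<in> path_image (circlepath \<kappa> r)"
      by (simp add: path_image_def)
    then have "circlepath \<kappa> r x \<notin> mat_spectrum A"
      using sphere_avoids_spectrum(2)[OF r \<kappa>] r0 by simp
    then have "resolvent B (?a (circlepath \<kappa> r x)) $ i $ j = resolvent A (circlepath \<kappa> r x) $ i $ j / of_real t"
      by (simp only: res not_False_eq_True vector_scaleR_component) (simp add: scaleR_conv_of_real)
    moreover have "circlepath (?a \<kappa>) (t * r) x = ?a (circlepath \<kappa> r x)"
      by (simp add: circlepath algebra_simps)
    ultimately show "F (circlepath (?a \<kappa>) (t * r) x) * resolvent B (circlepath (?a \<kappa>) (t * r) x) $ i $ j *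
          vector_derivative (circlepath (?a \<kappa>) (t * r)) (at x) =
        F (?a (circlepath \<kappa> r x)) * resolvent A (circlepath \<kappa> r x) $ i $ j *
          vector_derivative (circlepath \<kappa> r) (at x)"
      using t by (simp add: vector_derivative_circlepath)
  qed
  then have "circle_matrix_fun (t * r) F B = circle_matrix_fun r (\<lambda>w. F (?a w)) A"
    by (simp add: circle_matrix_fun_def spec sum.reindex[OF inj])
  then show ?thesis
    using matrix_fun_eq_circle[OF rB W(1) specW F] by (simp add: B_def b_def)
qed

section \<open>Dependence on parameters and the factor \<open>\<Omega>(A)\<close>\<close>

context
  fixes W :: "complex set" and M :: "complex^'n^'n" and r :: real
  assumes r: "isolating_radius W M r"
begin

lemma continuous_on_circle_integrand:
  assumes \<mu>: "\<mu> \<in> mat_spectrum M" and F: "continuous_on (K \<times> W) (\<lambda>(x, w). F x w)"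
  shows "continuous_on (K \<times> {0..1}) (\<lambda>(x, \<theta>). F x (circlepath \<mu> r \<theta>) *
    resolvent M (circlepath \<mu> r \<theta>) $ i $ j * vector_derivative (circlepath \<mu> r) (at \<theta>))"
proof -
  have r0: "r > 0"
    using r by (simp add: isolating_radius_def)
  have circ: "circlepath \<mu> r \<theta> \<in> path_image (circlepath \<mu> r)" if "\<theta> \<in> {0..1}" for \<theta>
    using that by (simp add: path_image_def)
  have cont: "continuous_on (K \<times> {0..1}) (\<lambda>x. circlepath \<mu> r (snd x))"
    unfolding circlepath by (intro continuous_intros)
  have "continuous_on (K \<times> {0..1}) (\<lambda>x. (\<lambda>(x, w). F x w) (fst x, circlepath \<mu> r (snd x)))"
    by (rule continuous_on_compose2[OF F])
       (use circ sphere_avoids_spectrum(1)[OF r \<mu>] r0 in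
         \<open>auto intro!: continuous_intros cont simp del: circlepath\<close>)
  moreover have "continuous_on (K \<times> {0..1}) (\<lambda>x. resolvent M (circlepath \<mu> r (snd x)) $ i $ j)"
    by (rule continuous_on_compose2[OF continuous_on_resolvent_circlepath[OF r \<mu>] cont])
       (use circ in auto)
  ultimately show ?thesis
    unfolding case_prod_unfold vector_derivative_circlepath by (auto intro!: continuous_intros)
qed

lemma continuous_on_circle_matrix_fun:
  assumes "continuous_on (K \<times> W) (\<lambda>(x, w). F x w)"
  shows "continuous_on K (\<lambda>x. circle_matrix_fun r (F x) M)"
proof -
  have "continuous_on K (\<lambda>x. integral (cbox 0 1) (\<lambda>\<theta>. F x (circlepath \<mu> r \<theta>) *
    resolvent M (circlepath \<mu> r \<theta>) $ i $ j * vector_derivative (circlepath \<mu> r) (at \<theta>)))"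
    if "\<mu> \<in> mat_spectrum M" for \<mu> i j
    using continuous_on_circle_integrand[OF that assms] by (intro integral_continuous_on_param) simp
  then show ?thesis
    unfolding circle_matrix_fun_def contour_integral_integral
    by (intro continuous_intros) auto
qed

text \<open>Fubini's theorem for a continuous integrand on the square of \<open>s\<close> and the
  circle parameter \<open>\<theta>\<close>. This provides the hypothesis on integrals in
  \<open>hermite_remainder_functional_bound\<close>.\<close>

lemma circle_matrix_fun_has_integral:
  assumes F: "continuous_on (W \<times> {0..1::real}) (\<lambda>(w, s). F w s)"
  shows "((\<lambda>s. circle_matrix_fun r (\<lambda>w. F w s) M $ i $ j) has_integral
    circle_matrix_fun r (\<lambda>w. integral {0..1} (F w)) M $ i $ j) {0..1}"
proof -
  have "continuous_on ({0..1} \<times> W) (\<lambda>x. (\<lambda>(w, s). F w s) (snd x, fst x))"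
    by (rule continuous_on_compose2[OF F]) (auto intro!: continuous_intros)
  then have F': "continuous_on ({0..1} \<times> W) (\<lambda>(s, w). F w s)"
    by (simp add: case_prod_unfold)
  define G where "G \<mu> s \<theta> = F (circlepath \<mu> r \<theta>) s *
    resolvent M (circlepath \<mu> r \<theta>) $ i $ j * vector_derivative (circlepath \<mu> r) (at \<theta>)" for \<mu> s \<theta>
  have G: "((\<lambda>s. integral {0..1} (G \<mu> s)) has_integral integral {0..1} (\<lambda>\<theta>. integral {0..1} (\<lambda>s. G \<mu> s \<theta>))) {0..1}"
    if "\<mu> \<in> mat_spectrum M" for \<mu>
  proof -
    have cont: "continuous_on (cbox 0 1 \<times> cbox 0 1) (\<lambda>(s, \<theta>). G \<mu> s \<theta>)"
      using continuous_on_circle_integrand[OF that F', of i j] by (simp add: G_def)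
    then have "continuous_on (cbox 0 1) (\<lambda>s. integral (cbox 0 1) (G \<mu> s))"
      by (rule integral_continuous_on_param)
    then have "(\<lambda>s. integral (cbox 0 1) (G \<mu> s)) integrable_on cbox 0 1"
      by (rule integrable_continuous)
    moreover have "integral (cbox 0 1) (\<lambda>s. integral (cbox 0 1) (G \<mu> s)) =
        integral (cbox 0 1) (\<lambda>\<theta>. integral (cbox 0 1) (\<lambda>s. G \<mu> s \<theta>))"
      by (rule integral_swap_continuous) (use cont in \<open>simp add: cbox_Pair_eq\<close>)
    ultimately show ?thesis
      by (simp add: has_integral_iff)
  qed
  have "circle_matrix_fun r (\<lambda>w. F w s) M $ i $ j =
      1 / (2 * of_real pi * \<i>) * (\<Sum>\<mu>\<in>mat_spectrum M. integral {0..1} (G \<mu> s))" for s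
    by (simp add: circle_matrix_fun_def contour_integral_integral G_def[abs_def])
  moreover have "circle_matrix_fun r (\<lambda>w. integral {0..1} (F w)) M $ i $ j =
      1 / (2 * of_real pi * \<i>) * (\<Sum>\<mu>\<in>mat_spectrum M. integral {0..1} (\<lambda>\<theta>. integral {0..1} (\<lambda>s. G \<mu> s \<theta>)))"
    by (simp add: circle_matrix_fun_def contour_integral_integral G_def integral_mult_left)
  ultimately show ?thesis
    by (simp only:) (intro has_integral_mult_right has_integral_sum finite_mat_spectrum G)
qed

text \<open>The order of the quantifiers is the point: one matrix \<open>P\<close> works for every
  \<open>g\<close>, so the choice \<open>g = 1\<close> can identify it.\<close>

lemma circle_matrix_fun_linear_factors:
  "\<exists>P. \<forall>g. g holomorphic_on W \<longrightarrow>
    circle_matrix_fun r (\<lambda>w. (\<Prod>z\<leftarrow>zs. w - z) * g w) M = P ** circle_matrix_fun r g M"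
proof (induction zs)
  case Nil
  show ?case
    by (intro exI[of _ "mat 1"]) simp
next
  case (Cons z zs)
  then obtain P where P: "\<And>g. g holomorphic_on W \<Longrightarrow>
      circle_matrix_fun r (\<lambda>w. (\<Prod>z\<leftarrow>zs. w - z) * g w) M = P ** circle_matrix_fun r g M"
    by blast
  have "circle_matrix_fun r (\<lambda>w. (\<Prod>z\<leftarrow>z # zs. w - z) * g w) M = ((M - mat z) ** P) ** circle_matrix_fun r g M"
    if g: "g holomorphic_on W" for g
  proof -
    have "(\<lambda>w. (\<Prod>z\<leftarrow>zs. w - z) * g w) holomorphic_on W"
      by (intro holomorphic_on_mult holomorphic_on_linear_factors g)
    from circle_matrix_fun_linear_factor[OF r this, of z] P[OF g] show ?thesis
      by (simp add: matrix_mul_assoc mult.assoc)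
  qed
  then show ?case
    by (intro exI[of _ "(M - mat z) ** P"]) simp
qed

end

text \<open>The common factor \<open>P\<close> is found by inserting the constant function 1, whose
  value at \<open>M\<close> is the identity by \<open>matrix_fun_one\<close>.\<close>

lemma circle_matrix_fun_prod_list:
  fixes M :: "complex^'n^'n"
  assumes r: "isolating_radius W M r" and W: "open W" "mat_spectrum M \<subseteq> W" and g: "g holomorphic_on W"
  shows "circle_matrix_fun r (\<lambda>w. (\<Prod>z\<leftarrow>zs. w - z) * g w) M =
    matrix_fun (\<lambda>w. \<Prod>z\<leftarrow>zs. w - z) M ** circle_matrix_fun r g M"
proof -
  obtain P where P: "\<And>g. g holomorphic_on W \<Longrightarrow>
      circle_matrix_fun r (\<lambda>w. (\<Prod>z\<leftarrow>zs. w - z) * g w) M = P ** circle_matrix_fun r g M"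
    using circle_matrix_fun_linear_factors[OF r] by metis
  have "matrix_fun (\<lambda>w. \<Prod>z\<leftarrow>zs. w - z) M = circle_matrix_fun r (\<lambda>w. (\<Prod>z\<leftarrow>zs. w - z) * 1) M"
    using matrix_fun_eq_circle[OF r W holomorphic_on_linear_factors] by simp
  also have "\<dots> = P ** circle_matrix_fun r (\<lambda>_. 1) M"
    by (rule P) simp
  also have "circle_matrix_fun r (\<lambda>_. 1) M = mat 1"
    using matrix_fun_eq_circle[OF r W, of "\<lambda>_. 1"] matrix_fun_one[of M] by simp
  finally show ?thesis
    using P[OF g] by simp
qed

section \<open>Norms and the interpolation error\<close>

text \<open>Convexity is the triangle inequality with homogeneity, and a convex function on a
  finite-dimensional space is continuous.\<close>

lemma norm_on_matrices_convex_continuous: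
  fixes N :: "complex^'n^'n \<Rightarrow> real"
  assumes "norm_on_matrices N"
  shows "convex_on UNIV N" and "continuous_on UNIV N"
proof -
  have scale: "N (u *\<^sub>R X) = \<bar>u\<bar> * N X" for u X
  proof -
    have "u *\<^sub>R X = map_matrix ((*) (of_real u)) X"
      by (simp add: vec_eq_iff map_matrix_def) (simp add: scaleR_conv_of_real)
    then show ?thesis
      using assms by (simp add: norm_on_matrices_def)
  qed
  show "convex_on UNIV N"
  proof (rule convex_onI)
    fix t :: real and X Y :: "complex^'n^'n" assume "0 < t" "t < 1"
    then show "N ((1 - t) *\<^sub>R X + t *\<^sub>R Y) \<le> (1 - t) * N X + t * N Y"
      using assms scale[of "1 - t" X] scale[of t Y] unfolding norm_on_matrices_def
      by (metis abs_of_pos diff_gt_0_iff_gt)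
  qed simp
  then show "continuous_on UNIV N"
    by (rule convex_on_continuous[OF open_UNIV])
qed

text \<open>A ball of \<open>N\<close> is closed and convex, so a real hyperplane separates it from
  \<open>B\<close>. The real functional is the real part of a complex linear one, and since the ball
  is invariant under unit complex scalars, the bound on the real part becomes one on the
  modulus.\<close>

lemma norm_on_matrices_separation:
  fixes N :: "complex^'n^'n \<Rightarrow> real"
  assumes N: "norm_on_matrices N" and m: "0 \<le> m" "m < N B"
  obtains c :: "complex^'n^'n" and b where
    "\<And>X. N X \<le> m \<Longrightarrow> cmod (\<Sum>i\<in>UNIV. \<Sum>j\<in>UNIV. c $ i $ j * X $ i $ j) \<le> b"
    "b < cmod (\<Sum>i\<in>UNIV. \<Sum>j\<in>UNIV. c $ i $ j * B $ i $ j)"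
proof -
  let ?S = "{X. N X \<le> m}"
  have "convex ?S"
  proof (rule convexI)
    fix X Y and u v :: real assume X: "X \<in> ?S" "Y \<in> ?S" and uv: "0 \<le> u" "0 \<le> v" "u + v = 1"
    have "N (u *\<^sub>R X + v *\<^sub>R Y) \<le> u * N X + v * N Y"
      using norm_on_matrices_convex_continuous(1)[OF N] uv by (simp add: convex_on_def)
    also have "\<dots> \<le> m"
      using X uv by (intro convex_bound_le) auto
    finally show "u *\<^sub>R X + v *\<^sub>R Y \<in> ?S"
      by simp
  qed
  moreover have "closed ?S"
    using norm_on_matrices_convex_continuous(2)[OF N] by (intro closed_Collect_le) auto
  moreover have "B \<notin> ?S"
    using m by simp
  ultimately have "\<exists>a b. a \<bullet> B < b \<and> (\<forall>X\<in>?S. b < a \<bullet> X)"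
    by (rule separating_hyperplane_closed_point)
  then obtain a b where ab: "a \<bullet> B < b" "\<And>X. N X \<le> m \<Longrightarrow> b < a \<bullet> X"
    by auto
  \<comment> \<open>The conjugate turns the real inner product into the real part of a complex
    linear form; the sign is there because the hyperplane theorem puts the ball on the side above
    \<open>b\<close>.\<close>
  define c :: "complex^'n^'n" where "c = (\<chi> i j. - cnj (a $ i $ j))"
  define \<psi> where "\<psi> X = (\<Sum>i\<in>UNIV. \<Sum>j\<in>UNIV. c $ i $ j * X $ i $ j)" for X :: "complex^'n^'n"
  have Re: "Re (\<psi> X) = - (a \<bullet> X)" for X
    by (simp add: \<psi>_def c_def inner_vec_def inner_complex_def sum_negf[symmetric])
  show ?thesis
  proof (rule that[of c "- b"])
    fix X assume X: "N X \<le> m"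
    \<comment> \<open>The rotation that makes the value of \<open>\<psi>\<close> real and
      nonnegative.\<close>
    define u where "u = (if \<psi> X = 0 then 1 else cnj (\<psi> X) / of_real (cmod (\<psi> X)))"
    have u: "cmod u = 1" "u * \<psi> X = of_real (cmod (\<psi> X))"
      by (auto simp: u_def norm_divide complex_norm_square[symmetric] mult.commute power2_eq_square)
    have "N (map_matrix ((*) u) X) \<le> m"
      using N X u(1) by (simp add: norm_on_matrices_def)
    from ab(2)[OF this] have "Re (\<psi> (map_matrix ((*) u) X)) \<le> - b"
      by (simp add: Re)
    moreover have "\<psi> (map_matrix ((*) u) X) = u * \<psi> X"
      by (simp add: \<psi>_def map_matrix_def sum_distrib_left mult_ac)
    ultimately have "cmod (\<psi> X) \<le> - b"
      by (simp only: u(2) Re_complex_of_real)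
    then show "cmod (\<Sum>i\<in>UNIV. \<Sum>j\<in>UNIV. c $ i $ j * X $ i $ j) \<le> - b"
      by (simp only: \<psi>_def)
  next
    have "- b < Re (\<psi> B)"
      using ab(1) by (simp add: Re)
    also have "\<dots> \<le> cmod (\<psi> B)"
      by (rule complex_Re_le_cmod)
    finally show "- b < cmod (\<Sum>i\<in>UNIV. \<Sum>j\<in>UNIV. c $ i $ j * B $ i $ j)"
      by (simp add: \<psi>_def)
  qed
qed

section \<open>Higher derivatives of polynomials\<close>

lemma higher_deriv_poly: "(deriv ^^ j) (poly p) = poly ((pderiv ^^ j) (p :: complex poly))"
proof (induction j)
  case (Suc j)
  then show ?case
    by (auto intro!: ext DERIV_imp_deriv poly_DERIV)
qed simp

lemma higher_pderiv_eq_0: "degree p < n \<Longrightarrow> (pderiv ^^ n) (p :: complex poly) = 0"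
proof (induction n arbitrary: p)
  case (Suc n)
  show ?case
  proof (cases "degree p = 0")
    case True
    then have "pderiv p = 0"
      by (simp add: pderiv_eq_0_iff)
    moreover have "(pderiv ^^ k) (0 :: complex poly) = 0" for k
      by (induction k) auto
    ultimately show ?thesis
      by (simp add: funpow_Suc_right del: funpow.simps)
  next
    case False
    then show ?thesis
      using Suc by (simp add: funpow_Suc_right degree_pderiv del: funpow.simps)
  qed
qed simp

section \<open>The error estimate for an arbitrary matrix norm\<close>

theorem theorem1:
  fixes A :: "complex^'d^'d" and n :: nat and z :: "nat \<Rightarrow> complex"
    and U :: "complex set" and f :: "complex \<Rightarrow> complex" and p :: "complex poly"
    and N :: "complex^'d^'d \<Rightarrow> real"
  assumes "n \<ge> 1"
    and "open U" and "convex hull (mat_spectrum A \<union> z ` {1..n}) \<subseteq> U" and "f analytic_on U"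
    and "hermite_interpolant f n z p"
    and "norm_on_matrices N"
  shows "let S = {N (matrix_fun (\<lambda>w. \<Prod>k=1..n. w - z k) A **
                     matrix_fun ((deriv ^^ n) f) (mat (of_real (1 - t) * \<mu>) + t *\<^sub>R A)) | t \<mu>.
                    t \<in> {0..1} \<and> \<mu> \<in> convex hull (z ` {1..n})}
         in \<exists>m. m \<in> S \<and> (\<forall>s\<in>S. s \<le> m) \<and>
                N (matrix_fun f A - matrix_fun (poly p) A) \<le> 1 / fact n * m"
proof -
  define K where "K = convex hull (mat_spectrum A \<union> z ` {1..n})"
  define H where "H = convex hull (z ` {1..n})"
  have "compact K"
    unfolding K_def using finite_mat_spectrum[of A] by (intro finite_imp_compact_convex_hull) auto
  then obtain \<epsilon> where \<epsilon>: "\<epsilon> > 0" "(\<Union>x\<in>K. ball x \<epsilon>) \<subseteq> U"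
    using compact_subset_open_imp_ball_epsilon_subset assms(2,3) K_def by metis
  \<comment> \<open>\<open>U\<close> may fail to be convex. This neighbourhood of \<open>K\<close>
    inside \<open>U\<close> is convex, being the Minkowski sum of \<open>K\<close> and a
    ball.\<close>
  define W where "W = (\<Union>x\<in>K. ball x \<epsilon>)"
  have W1: "open W"
    unfolding W_def by auto
  have "ball x \<epsilon> = (\<Union>y\<in>ball 0 \<epsilon>. {x + y})" for x :: complex
  proof -
    have "ball x \<epsilon> = (+) x ` ball 0 \<epsilon>"
      by simp
    then show ?thesis by blast
  qed
  then have "W = (\<Union>x\<in>K. \<Union>y\<in>ball 0 \<epsilon>. {x + y})"
    unfolding W_def by (rule SUP_cong[OF refl])
  moreover have "convex K"
    by (simp add: K_def)
  ultimately have W2: "convex W"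
    using convex_sums[OF _ convex_ball] by metis
  note W = W1 W2
  have KW: "K \<subseteq> W"
    unfolding W_def using \<epsilon>(1) by auto
  then have specW: "mat_spectrum A \<subseteq> W" and zW: "z ` {1..n} \<subseteq> W"
    unfolding K_def using hull_subset[of "mat_spectrum A \<union> z ` {1..n}" convex] by auto
  have HW: "H \<subseteq> W"
    unfolding H_def using zW W(2) by (rule hull_minimal)
  have f: "f holomorphic_on W"
    using assms(4) \<epsilon>(2) analytic_imp_holomorphic holomorphic_on_subset W_def by blast
  have p: "poly p holomorphic_on W"
    by (intro holomorphic_intros)
  define h where "h w = f w - poly p w" for w
  have h: "h holomorphic_on W"
    unfolding h_def using f p by (rule holomorphic_on_diff)
  have deriv_h: "(deriv ^^ j) h v = (deriv ^^ j) f v - poly ((pderiv ^^ j) p) v" if "v \<in> W" for j v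
    unfolding h_def higher_deriv_diff[OF f p W(1) that] higher_deriv_poly ..
  define zs where "zs = map z [1..<Suc n]"
  have len: "length zs = n" and set: "set zs = z ` {1..n}"
    by (auto simp: zs_def atLeastLessThanSuc_atLeastAtMost)
  have prod: "(\<Prod>k=1..n. w - z k) = (\<Prod>x\<leftarrow>zs. w - x)" for w
    using prod.distinct_set_conv_list[of "[1..<Suc n]" "\<lambda>k. w - z k"]
    by (simp add: zs_def o_def atLeastLessThanSuc_atLeastAtMost del: upt_Suc)
  have count: "count_list zs v = card {k \<in> {1..n}. z k = v}" for v
  proof -
    have "count_list zs v = length (filter (\<lambda>k. v = z k) [1..<Suc n])"
      by (simp add: zs_def count_list_eq_length_filter filter_map o_def del: upt_Suc)
    also have "\<dots> = card ({k. v = z k} \<inter> {1..n})"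
      by (simp add: distinct_length_filter atLeastLessThanSuc_atLeastAtMost del: upt_Suc)
    also have "{k. v = z k} \<inter> {1..n} = {k \<in> {1..n}. z k = v}"
      by auto
    finally show ?thesis .
  qed
  have vanish: "(deriv ^^ j) h v = 0" if "v \<in> W" "j < count_list zs v" for v j
  proof -
    have "v \<in> set zs"
      using that(2) count_list_0_iff[of zs v] by (metis not_less_zero)
    then have "poly ((pderiv ^^ j) p) v = (deriv ^^ j) f v"
      using assms(5) that(2) unfolding hermite_interpolant_def count set by blast
    then show ?thesis
      by (simp add: deriv_h[OF that(1)])
  qed
  let ?F = "(deriv ^^ n) f"
  have F: "?F holomorphic_on W"
    by (rule holomorphic_higher_deriv[OF f W(1)])
  \<comment> \<open>Here \<open>n \<ge> 1\<close> enters: it makes the truncated bound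
    \<open>n - 1\<close> strictly smaller than \<open>n\<close>.\<close>
  have "degree p < n"
    using assms(1,5) unfolding hermite_interpolant_def by linarith
  then have deriv_n: "(deriv ^^ n) h v = ?F v" if "v \<in> W" for v
    using deriv_h[OF that] by (simp add: higher_pderiv_eq_0)
  obtain r where r: "isolating_radius W A r"
    using isolating_radius_exists[OF W(1) specW] .
  define \<Omega> where "\<Omega> = matrix_fun (\<lambda>w. \<Prod>k=1..n. w - z k) A"
  \<comment> \<open>On the fixed circles around the spectrum of \<open>A\<close> the matrix is
    visibly continuous in \<open>t\<close> and \<open>\<mu>\<close> jointly, so the maximum over the
    compact set \<open>{0..1} \<times> H\<close> is attained.\<close>
  define \<Phi> where "\<Phi> x = circle_matrix_fun r (\<lambda>w. ?F ((1 - of_real (fst x)) * snd x + of_real (fst x) * w)) A"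
    for x :: "real \<times> complex"
  define S where "S = (\<lambda>x. N (\<Omega> ** \<Phi> x)) ` ({0..1} \<times> H)"
  have comb: "(1 - of_real t) * \<mu> + of_real t * w \<in> W" if "t \<in> {0..1}" "\<mu> \<in> H" "w \<in> W" for t \<mu> w
    using convex_comb_mem[OF W(2) _ that(3,1)] HW that(2) by auto
  have S_eq: "{N (matrix_fun (\<lambda>w. \<Prod>k=1..n. w - z k) A **
      matrix_fun ?F (mat (of_real (1 - t) * \<mu>) + t *\<^sub>R A)) | t \<mu>.
      t \<in> {0..1} \<and> \<mu> \<in> convex hull (z ` {1..n})} = S"
  proof -
    have "matrix_fun ?F (mat (of_real (1 - t) * \<mu>) + t *\<^sub>R A) = \<Phi> (t, \<mu>)"
      if "t \<in> {0..1}" "\<mu> \<in> H" for t \<mu>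
      using matrix_fun_eq_affine_circle[OF W r specW F that(1)] HW that(2) by (auto simp: \<Phi>_def)
    then show ?thesis
      unfolding S_def \<Omega>_def[symmetric] H_def[symmetric] by (force simp: image_iff)
  qed
  have "continuous_on (({0..1} \<times> H) \<times> W)
      (\<lambda>y. ?F ((1 - of_real (fst (fst y))) * snd (fst y) + of_real (fst (fst y)) * snd y))"
    by (rule continuous_on_compose2[OF holomorphic_on_imp_continuous_on[OF F]])
       (use comb in \<open>auto intro!: continuous_intros\<close>)
  then have "continuous_on ({0..1} \<times> H) \<Phi>"
    unfolding \<Phi>_def by (intro continuous_on_circle_matrix_fun[OF r]) (simp add: case_prod_unfold)
  then have "continuous_on ({0..1} \<times> H) (\<lambda>x. \<Omega> ** \<Phi> x)"
    unfolding matrix_matrix_mult_def by (intro continuous_intros)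
  then have cont: "continuous_on ({0..1} \<times> H) (\<lambda>x. N (\<Omega> ** \<Phi> x))"
    by (rule continuous_on_compose2[OF norm_on_matrices_convex_continuous(2)[OF assms(6)]]) auto
  have "compact H"
    unfolding H_def by (intro finite_imp_compact_convex_hull) auto
  then have "compact S"
    unfolding S_def by (intro compact_continuous_image[OF cont] compact_Times) auto
  have "z 1 \<in> H"
    unfolding H_def using assms(1) by (intro hull_inc) auto
  then have "S \<noteq> {}"
    unfolding S_def by auto
  with \<open>compact S\<close> obtain m where m: "m \<in> S" "\<And>s. s \<in> S \<Longrightarrow> s \<le> m"
    using compact_attains_sup[of S] by blast
  have "0 \<le> m"
    using m(1) assms(6) by (auto simp: S_def norm_on_matrices_def)
  let ?B = "matrix_fun f A - matrix_fun (poly p) A"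
  have B: "?B = circle_matrix_fun r h A"
    unfolding h_def matrix_fun_eq_circle[OF r W(1) specW f] matrix_fun_eq_circle[OF r W(1) specW p]
    by (rule circle_matrix_fun_diff[OF r, symmetric])
       (intro holomorphic_on_imp_continuous_on f p)+
  have "N ?B \<le> m / fact n"
  proof (rule ccontr)
    assume "\<not> N ?B \<le> m / fact n"
    then obtain c :: "complex^'d^'d" and b where
      cb: "\<And>X. N X \<le> m / fact n \<Longrightarrow> cmod (\<Sum>i\<in>UNIV. \<Sum>j\<in>UNIV. c $ i $ j * X $ i $ j) \<le> b"
      "b < cmod (\<Sum>i\<in>UNIV. \<Sum>j\<in>UNIV. c $ i $ j * ?B $ i $ j)"
      using norm_on_matrices_separation[OF assms(6), of "m / fact n" ?B] \<open>0 \<le> m\<close> by auto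
    \<comment> \<open>The separating functional evaluated at \<open>\<Omega> ** g(A)\<close>,
      written in entries so that its linearity and its behaviour under integrals can be read
      off.\<close>
    define T where "T g = (\<Sum>i\<in>UNIV. \<Sum>j\<in>UNIV. c $ i $ j *
      (\<Sum>k\<in>UNIV. \<Omega> $ i $ k * circle_matrix_fun r g A $ k $ j))" for g
    have T_eq: "T g = (\<Sum>i\<in>UNIV. \<Sum>j\<in>UNIV. c $ i $ j * (\<Omega> ** circle_matrix_fun r g A) $ i $ j)" for g
      by (simp add: T_def matrix_matrix_mult_def)
    have T_cong: "T g1 = T g2" if "\<And>w. w \<in> W \<Longrightarrow> g1 w = g2 w" for g1 g2
      unfolding T_def using circle_matrix_fun_cong[OF r that] by simp
    \<comment> \<open>The constant \<open>b * fact n\<close> is chosen so that the factorial cancels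
      and \<open>cmod (T g) \<le> b\<close> remains.\<close>
    have "\<exists>g. g holomorphic_on W \<and> (\<forall>w\<in>W. h w = (\<Prod>z\<leftarrow>zs. w - z) * g w) \<and>
      cmod (T g) \<le> (b * fact n) / fact (length zs)"
    proof (rule hermite_remainder_functional_bound[OF W T_cong _ _ h _ vanish])
      show "T (\<lambda>w. a * g w) = a * T g" if "g holomorphic_on W" for a g
        using circle_matrix_fun_scale[OF r holomorphic_on_imp_continuous_on[OF that]]
        by (simp add: T_def sum_distrib_left mult_ac)
      show "((\<lambda>s. T (\<lambda>w. F w s)) has_integral T (\<lambda>w. integral {0..1} (F w))) {0..1}"
        if "continuous_on (W \<times> {0..1::real}) (\<lambda>(w, s). F w s)" for F
        unfolding T_def
        by (intro has_integral_sum has_integral_mult_right circle_matrix_fun_has_integral[OF r that]) auto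
      show "set zs \<subseteq> W"
        using set zW by simp
      fix t :: real and \<mu> assume t: "t \<in> {0..1}" "t = 1 \<or> \<mu> \<in> convex hull set zs"
      \<comment> \<open>At \<open>t = 1\<close> the point \<open>\<mu>\<close> is unrestricted but
        has weight zero, so the node \<open>z 1\<close> may replace it.\<close>
      obtain \<nu> where \<nu>: "\<nu> \<in> H" "\<And>w. (1 - of_real t) * \<mu> + of_real t * w = (1 - of_real t) * \<nu> + of_real t * w"
        using t(2) \<open>z 1 \<in> H\<close> set H_def by auto
      have "T (\<lambda>w. (deriv ^^ n) h ((1 - of_real t) * \<mu> + of_real t * w)) =
          T (\<lambda>w. ?F ((1 - of_real t) * \<nu> + of_real t * w))"
        unfolding \<nu>(2) using deriv_n comb[OF t(1) \<nu>(1)] by (intro T_cong) auto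
      also have "\<dots> = (\<Sum>i\<in>UNIV. \<Sum>j\<in>UNIV. c $ i $ j * (\<Omega> ** \<Phi> (t, \<nu>)) $ i $ j)"
        by (simp add: T_eq \<Phi>_def)
      \<comment> \<open>Scaling by \<open>1 / fact n\<close> brings the matrix into the ball of
        radius \<open>m / fact n\<close>, where the separating functional is at most
        \<open>b\<close> in modulus.\<close>
      also have "\<dots> = fact n * (\<Sum>i\<in>UNIV. \<Sum>j\<in>UNIV. c $ i $ j *
          map_matrix ((*) (1 / fact n)) (\<Omega> ** \<Phi> (t, \<nu>)) $ i $ j)"
        by (simp add: map_matrix_def sum_distrib_left)
      also have "cmod \<dots> \<le> fact n * b"
      proof -
        have "N (\<Omega> ** \<Phi> (t, \<nu>)) \<le> m"
          using t(1) \<nu>(1) by (intro m(2)) (auto simp: S_def)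
        then have "N (map_matrix ((*) (1 / fact n)) (\<Omega> ** \<Phi> (t, \<nu>))) \<le> m / fact n"
          using assms(6) by (simp add: norm_on_matrices_def norm_divide divide_right_mono)
        from cb(1)[OF this] show ?thesis
          by (simp add: norm_mult)
      qed
      finally show "cmod (T (\<lambda>w. (deriv ^^ length zs) h ((1 - of_real t) * \<mu> + of_real t * w))) \<le> b * fact n"
        by (simp add: len mult.commute)
    qed
    then obtain g where g: "g holomorphic_on W" "\<And>w. w \<in> W \<Longrightarrow> h w = (\<Prod>z\<leftarrow>zs. w - z) * g w"
      "cmod (T g) \<le> b"
      by (auto simp: len)
    \<comment> \<open>Since \<open>?B\<close> equals \<open>\<Omega> ** g(A)\<close>, the functional
      takes the value \<open>T g\<close> at \<open>?B\<close>, and \<open>cmod (T g) \<le> b\<close>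
      contradicts the separation.\<close>
    have "?B = circle_matrix_fun r (\<lambda>w. (\<Prod>z\<leftarrow>zs. w - z) * g w) A"
      unfolding B by (rule circle_matrix_fun_cong[OF r g(2)])
    also have "\<dots> = \<Omega> ** circle_matrix_fun r g A"
      unfolding \<Omega>_def prod by (rule circle_matrix_fun_prod_list[OF r W(1) specW g(1)])
    finally show False
      using cb(2) g(3) by (simp add: T_eq)
  qed
  then show ?thesis
    unfolding S_eq Let_def using m by (intro exI[of _ m]) auto
qed

end
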